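(* Let $F_q$ be a finite field with $q$ elements and let $R$ be a finite indecomposable associative algebra with unity over $F_q$. Let $I_q = \{x \in R \mid x^q = x\}$ and $r_q = \frac{|I_q|}{|R|}$. If $r_q = \frac{q^2 - q + 1}{q^2}$, then $R \simeq S$, where $S$ is the $F_q$-algebra with unity, of cardinality $q^3$, generated by $F_q$ and symbols $e_1, e_2$ subject to the multiplication rules $e_i e_j = e_i$ for $1 \leq i, j \leq 2$.
   Context: All rings and algebras are associative with unity. A ring is indecomposable if it is not a direct product of two (nonzero) rings. Concretely, $S$ is the $3$-dimensional $F_q$-vector space with basis $1, e_1, e_2$, where $1$ is the unity and the remaining products of basis elements are $e_1e_1 = e_1$, $e_1e_2 = e_1$, $e_2e_1 = e_2$, $e_2e_2 = e_2$. The isomorphism $R \simeq S$ is an isomorphism of $F_q$-algebras. *)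

theory Defs
  imports Complex_Main "HOL-Algebra.Module" "HOL-Algebra.Chinese_Remainder"
begin

(* The library's locale algebra requires the algebra to be commutative. *)
locale assoc_algebra = module R M + ring M for R (structure) and M (structure) +
  assumes smult_assoc2:
      "\<lbrakk> a \<in> carrier R; x \<in> carrier M; y \<in> carrier M \<rbrakk> \<Longrightarrow>
      (a \<odot>\<^bsub>M\<^esub> x) \<otimes>\<^bsub>M\<^esub> y = a \<odot>\<^bsub>M\<^esub> (x \<otimes>\<^bsub>M\<^esub> y)"
    and smult_assoc3:
      "\<lbrakk> a \<in> carrier R; x \<in> carrier M; y \<in> carrier M \<rbrakk> \<Longrightarrow>
      x \<otimes>\<^bsub>M\<^esub> (a \<odot>\<^bsub>M\<^esub> y) = a \<odot>\<^bsub>M\<^esub> (x \<otimes>\<^bsub>M\<^esub> y)"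

definition algebra_iso ::
    "('k, 'c) ring_scheme \<Rightarrow> ('k, 'a, 'm) module_scheme \<Rightarrow> ('k, 'b, 'n) module_scheme \<Rightarrow> ('a \<Rightarrow> 'b) set"
  where "algebra_iso K A B =
    {h \<in> ring_iso A B. \<forall>a \<in> carrier K. \<forall>x \<in> carrier A. h (a \<odot>\<^bsub>A\<^esub> x) = a \<odot>\<^bsub>B\<^esub> h x}"

definition algebra_isomorphic ::
    "('k, 'c) ring_scheme \<Rightarrow> ('k, 'a, 'm) module_scheme \<Rightarrow> ('k, 'b, 'n) module_scheme \<Rightarrow> bool"
  where "algebra_isomorphic K A B \<longleftrightarrow> algebra_iso K A B \<noteq> {}"

(* Taking both factors over the element type of R loses nothing: the factors of any
   direct product decomposition of R embed (additively and multiplicatively) in R. *)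
definition indecomposable_ring :: "('a, 'm) ring_scheme \<Rightarrow> bool"
  where "indecomposable_ring R \<longleftrightarrow>
    \<not> (\<exists>(A :: 'a ring) (B :: 'a ring). ring A \<and> ring B
        \<and> carrier A \<noteq> {\<zero>\<^bsub>A\<^esub>} \<and> carrier B \<noteq> {\<zero>\<^bsub>B\<^esub>} \<and> R \<simeq> RDirProd A B)"

definition I_set :: "('a, 'm) ring_scheme \<Rightarrow> nat \<Rightarrow> 'a set"
  where "I_set R q = {x \<in> carrier R. x [^]\<^bsub>R\<^esub> q = x}"

definition r_ratio :: "('a, 'm) ring_scheme \<Rightarrow> nat \<Rightarrow> real"
  where "r_ratio R q = real (card (I_set R q)) / real (card (carrier R))"

(* The triple (a, b, c) stands for a 1 + b e1 + c e2; the product is the bilinear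
   extension of e_i e_j = e_i with 1 as unity. *)
definition S_alg :: "('k, 'c) ring_scheme \<Rightarrow> ('k, 'k \<times> 'k \<times> 'k) module"
  where "S_alg F =
    \<lparr> carrier = carrier F \<times> carrier F \<times> carrier F,
      mult = (\<lambda>(a, b, c) (a', b', c').
        (a \<otimes>\<^bsub>F\<^esub> a',
         a \<otimes>\<^bsub>F\<^esub> b' \<oplus>\<^bsub>F\<^esub> b \<otimes>\<^bsub>F\<^esub> a' \<oplus>\<^bsub>F\<^esub> b \<otimes>\<^bsub>F\<^esub> b' \<oplus>\<^bsub>F\<^esub> b \<otimes>\<^bsub>F\<^esub> c',
         a \<otimes>\<^bsub>F\<^esub> c' \<oplus>\<^bsub>F\<^esub> c \<otimes>\<^bsub>F\<^esub> a' \<oplus>\<^bsub>F\<^esub> c \<otimes>\<^bsub>F\<^esub> b' \<oplus>\<^bsub>F\<^esub> c \<otimes>\<^bsub>F\<^esub> c')),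
      one = (\<one>\<^bsub>F\<^esub>, \<zero>\<^bsub>F\<^esub>, \<zero>\<^bsub>F\<^esub>),
      zero = (\<zero>\<^bsub>F\<^esub>, \<zero>\<^bsub>F\<^esub>, \<zero>\<^bsub>F\<^esub>),
      add = (\<lambda>(a, b, c) (a', b', c'). (a \<oplus>\<^bsub>F\<^esub> a', b \<oplus>\<^bsub>F\<^esub> b', c \<oplus>\<^bsub>F\<^esub> c')),
      smult = (\<lambda>k (a, b, c). (k \<otimes>\<^bsub>F\<^esub> a, k \<otimes>\<^bsub>F\<^esub> b, k \<otimes>\<^bsub>F\<^esub> c)) \<rparr>"

definition S_e1 :: "('k, 'c) ring_scheme \<Rightarrow> 'k \<times> 'k \<times> 'k"
  where "S_e1 F = (\<zero>\<^bsub>F\<^esub>, \<one>\<^bsub>F\<^esub>, \<zero>\<^bsub>F\<^esub>)"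

definition S_e2 :: "('k, 'c) ring_scheme \<Rightarrow> 'k \<times> 'k \<times> 'k"
  where "S_e2 F = (\<zero>\<^bsub>F\<^esub>, \<zero>\<^bsub>F\<^esub>, \<one>\<^bsub>F\<^esub>)"

context cring
begin

lemma S_table:
  "S_e1 R \<otimes>\<^bsub>S_alg R\<^esub> S_e1 R = S_e1 R"
  "S_e1 R \<otimes>\<^bsub>S_alg R\<^esub> S_e2 R = S_e1 R"
  "S_e2 R \<otimes>\<^bsub>S_alg R\<^esub> S_e1 R = S_e2 R"
  "S_e2 R \<otimes>\<^bsub>S_alg R\<^esub> S_e2 R = S_e2 R"
  by (simp_all add: S_alg_def S_e1_def S_e2_def)

lemma S_coordinates:
  assumes "a \<in> carrier R" "b \<in> carrier R" "c \<in> carrier R"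
  shows "(a, b, c) = a \<odot>\<^bsub>S_alg R\<^esub> \<one>\<^bsub>S_alg R\<^esub> \<oplus>\<^bsub>S_alg R\<^esub> b \<odot>\<^bsub>S_alg R\<^esub> S_e1 R \<oplus>\<^bsub>S_alg R\<^esub> c \<odot>\<^bsub>S_alg R\<^esub> S_e2 R"
  using assms by (simp add: S_alg_def S_e1_def S_e2_def)

lemma S_card: "card (carrier (S_alg R)) = card (carrier R) ^ 3"
  by (simp add: S_alg_def card_cartesian_product power3_eq_cube)

lemma S_abelian_group: "abelian_group (S_alg R)"
proof (rule abelian_groupI)
  fix x assume "x \<in> carrier (S_alg R)"
  then obtain a b c where "x = (a, b, c)" "a \<in> carrier R" "b \<in> carrier R" "c \<in> carrier R"
    by (auto simp: S_alg_def)
  then show "\<exists>y\<in>carrier (S_alg R). y \<oplus>\<^bsub>S_alg R\<^esub> x = \<zero>\<^bsub>S_alg R\<^esub>"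
    by (intro bexI[of _ "(\<ominus> a, \<ominus> b, \<ominus> c)"]) (auto simp: S_alg_def l_neg)
qed (auto simp: S_alg_def a_ac)

lemma S_ring: "ring (S_alg R)"
proof (rule ringI)
  show "abelian_group (S_alg R)" by (rule S_abelian_group)
  show "monoid (S_alg R)"
    by (rule monoidI) (auto simp: S_alg_def l_distr r_distr a_ac m_ac)
qed (auto simp: S_alg_def l_distr r_distr a_ac m_ac)

lemma S_assoc_algebra: "assoc_algebra R (S_alg R)"
proof -
  interpret S: ring "S_alg R" by (rule S_ring)
  have "module R (S_alg R)"
    by (rule moduleI[OF is_cring S_abelian_group])
      (auto simp: S_alg_def l_distr r_distr m_assoc)
  moreover have "assoc_algebra_axioms R (S_alg R)"
    by unfold_locales (auto simp: S_alg_def l_distr r_distr a_ac m_ac)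
  ultimately show ?thesis
    by (intro assoc_algebra.intro S_ring)
qed

end

end

theory Submission
  imports Defs "HOL-Algebra.Multiplicative_Group"
begin

text \<open>
  Write \<open>A\<close> for the algebra, \<open>I\<close> for its set of solutions of \<open>x\<^sup>q = x\<close> and \<open>C(x)\<close> for the centralizer of \<open>x\<close>. The algebra
  \<open>S\<close> is the algebra of upper triangular \<open>2 \<times> 2\<close> matrices over \<open>F\<close> in disguise: the diagonal matrix units
  \<open>e\<close>, \<open>f\<close> and the corner unit \<open>n\<close> give \<open>e\<^sub>1 = f\<close> and \<open>e\<^sub>2 = f + n\<close>. The hypothesis says that the complement
  of \<open>I\<close> has density exactly \<open>(q - 1)/q\<^sup>2\<close>. Two counting arguments, one along lines through an
  idempotent and one along lines through a square-zero element, show that this forces the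
  triangular structure.

  \<^emph>\<open>Idempotents have large centralizers.\<close> Let \<open>e\<close> be idempotent. The \<open>q\<close> translates \<open>x + t e\<close> of a random
  \<open>x\<close> all lie in \<open>I\<close> with probability at least \<open>1 - q (q - 1)/q\<^sup>2 = 1/q\<close>. If they do, then
  \<open>(x + t e)\<^sup>q = x + t e\<close> is an identity between polynomials in \<open>t\<close> that, after \<open>t\<^sup>q = t\<close> is used, have
  degree below \<open>q\<close>, so coefficients may be compared (\<open>horner_vanish\<close>). The coefficient of \<open>t\<close> gives
  \<open>\<Sum>\<^sub>i x\<^sup>i e x\<^sup>q\<^sup>-\<^sup>1\<^sup>-\<^sup>i = 0\<close>, and the commutator of this sum with \<open>x\<close> telescopes to \<open>x\<^sup>q e - e x\<^sup>q = x e - e x\<close>.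
  Hence \<open>x\<close> commutes with \<open>e\<close>, and \<open>C(e)\<close> has index at most \<open>q\<close> (\<open>card_centralizer_idempotent\<close>).

  \<^emph>\<open>A noncentral idempotent exists.\<close> In an indecomposable algebra the only central idempotents are \<open>0\<close>
  and \<open>1\<close>. If these were all the idempotents, then every \<open>x\<close> in \<open>I\<close> would be a scalar
  (\<open>I_set_scalar_of_trivial_idempotents\<close>), and \<open>|I| \<le> q\<close> is incompatible with the given density.

  \<^emph>\<open>Peirce decomposition.\<close> Let \<open>e\<close> be a noncentral idempotent and \<open>f = 1 - e\<close>. As an additive group, the
  algebra is the sum of \<open>C(e)\<close>, \<open>e A f\<close> and \<open>f A e\<close>, so \<open>|e A f| |f A e| \<le> q\<close>. After exchanging \<open>e\<close> and \<open>f\<close> if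
  necessary, \<open>e A f = F n\<close> with \<open>n \<noteq> 0\<close>, \<open>n\<^sup>2 = 0\<close>, and \<open>f A e = 0\<close>.

  \<^emph>\<open>The corners lie in \<open>I\<close>.\<close> The map \<open>x \<mapsto> x n - n x\<close> takes values in \<open>F n\<close>, so \<open>C(n)\<close> has index at most \<open>q\<close>.
  If \<open>y\<close> commutes with \<open>n\<close>, then \<open>(y + t n)\<^sup>q = y\<^sup>q\<close>; therefore each line \<open>y + F n\<close> in \<open>C(n)\<close> contains at most one point
  of \<open>I\<close>. The other points of these lines already account for the whole complement of \<open>I\<close>, so each line
  contains exactly one point of \<open>I\<close> (\<open>centralizer_arrow_meets_I\<close>). It follows that \<open>e A e\<close> and \<open>f A f\<close> are contained in
  \<open>I\<close>.

  \<^emph>\<open>The corners are one-dimensional.\<close> A corner contained in \<open>I\<close> has no nonzero square-zero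
  elements, so its idempotents are central in it. If \<open>a \<noteq> 0\<close> in \<open>e A e\<close> killed \<open>n\<close>, then \<open>a\<^sup>q\<^sup>-\<^sup>1\<close> would be a
  nontrivial central idempotent of the whole algebra. Hence \<open>a \<mapsto> a n\<close> embeds \<open>e A e\<close> into \<open>F n\<close>, and
  likewise \<open>b \<mapsto> n b\<close> embeds \<open>f A f\<close>. So \<open>A = F e + F n + F f\<close>.
\<close>

section \<open>Finite algebras over a finite field\<close>

locale finite_algebra = ring A + F: field F + S: assoc_algebra F A
  for A :: "('k, 'a, 'm) module_scheme" (structure) and F :: "('k, 'c) ring_scheme" (structure) +
  fixes q :: nat
  assumes F_finite: "finite (carrier F)" and F_card: "card (carrier F) = q"
    and A_finite: "finite (carrier A)"
begin

lemmas smult_simps = S.smult_l_distr S.smult_r_distr S.smult_assoc2 S.smult_assoc3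
  S.smult_l_minus S.smult_r_minus

lemma smult_comm:
  assumes "s \<in> carrier F" "t \<in> carrier F" "x \<in> carrier A"
  shows "s \<odot> (t \<odot> x) = t \<odot> (s \<odot> x)"
  using assms by (metis S.smult_assoc1 F.m_comm)

lemma smult_cancel:
  assumes "t \<in> carrier F" "t \<noteq> \<zero>\<^bsub>F\<^esub>" "x \<in> carrier A" "t \<odot> x = \<zero>"
  shows "x = \<zero>"
proof -
  have u: "t \<in> Units F" using assms F.field_Units by simp
  have "x = (inv\<^bsub>F\<^esub> t \<otimes>\<^bsub>F\<^esub> t) \<odot> x" using u assms(3) by simp
  also have "\<dots> = inv\<^bsub>F\<^esub> t \<odot> (t \<odot> x)" using u assms(1,3) by (intro S.smult_assoc1) auto
  also have "\<dots> = \<zero>" using u assms(4) by simp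
  finally show ?thesis .
qed

text \<open>
  For \<open>x \<noteq> 0\<close> the line \<open>F x\<close> has exactly \<open>q\<close> points; both counting arguments depend on this.
\<close>
lemma smult_cancel_right:
  assumes "s \<in> carrier F" "t \<in> carrier F" "x \<in> carrier A" "x \<noteq> \<zero>" "s \<odot> x = t \<odot> x"
  shows "s = t"
proof -
  have "(s \<ominus>\<^bsub>F\<^esub> t) \<odot> x = \<zero>"
    using assms by (simp add: F.minus_eq S.smult_l_distr S.smult_l_minus r_neg)
  then have "s \<ominus>\<^bsub>F\<^esub> t = \<zero>\<^bsub>F\<^esub>"
    using smult_cancel[of "s \<ominus>\<^bsub>F\<^esub> t" x] assms by auto
  then show ?thesis using assms by simp
qed

lemma q_ge_2: "2 \<le> q"
proof -
  have "card {\<zero>\<^bsub>F\<^esub>, \<one>\<^bsub>F\<^esub>} \<le> card (carrier F)"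
    by (rule card_mono) (auto simp: F_finite)
  then show ?thesis by (simp add: F_card F.one_not_zero[symmetric] del: F.one_not_zero)
qed

lemma scalar_pow_q:
  assumes "t \<in> carrier F"
  shows "t [^]\<^bsub>F\<^esub> q = t"
proof (cases "t = \<zero>\<^bsub>F\<^esub>")
  case True
  then show ?thesis using q_ge_2 by (simp add: F.nat_pow_zero)
next
  case False
  interpret G: group "mult_of F" by (rule F.field_mult_group)
  have "t [^]\<^bsub>mult_of F\<^esub> order (mult_of F) = \<one>\<^bsub>mult_of F\<^esub>"
    using assms False by (intro G.pow_order_eq_1) (auto simp: F_finite)
  then have "t [^]\<^bsub>F\<^esub> (q - 1) = \<one>\<^bsub>F\<^esub>"
    using F.order_mult_of[OF F_finite] by (simp add: nat_pow_mult_of order_def F_card)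
  moreover have "t [^]\<^bsub>F\<^esub> q = t [^]\<^bsub>F\<^esub> (q - 1) \<otimes>\<^bsub>F\<^esub> t"
    using q_ge_2 by (metis F.nat_pow_Suc Suc_diff_1 One_nat_def Suc_1 less_le_trans zero_less_Suc)
  ultimately show ?thesis using assms by simp
qed

lemma add_pow_q_eq_zero:
  assumes "x \<in> carrier A"
  shows "[q] \<cdot> x = \<zero>"
proof -
  have "\<one>\<^bsub>F\<^esub> [^]\<^bsub>add_monoid F\<^esub> order (add_monoid F) = \<one>\<^bsub>add_monoid F\<^esub>"
    by (rule group.pow_order_eq_1[OF F.a_group]) (auto simp: F_finite)
  then have one: "[q] \<cdot>\<^bsub>F\<^esub> \<one>\<^bsub>F\<^esub> = \<zero>\<^bsub>F\<^esub>"
    by (simp add: add_pow_def order_def F_card)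
  have "[k] \<cdot> x = ([k] \<cdot>\<^bsub>F\<^esub> \<one>\<^bsub>F\<^esub>) \<odot> x" for k :: nat
    by (induction k) (use assms in \<open>simp_all add: S.smult_l_distr\<close>)
  then show ?thesis using one assms by simp
qed

section \<open>Polynomial functions with coefficients in the algebra\<close>

text \<open>
  The value at the scalar \<open>t\<close> of the polynomial \<open>\<Sum>\<^sub>k\<^sub><\<^sub>m t\<^sup>k c\<^sub>k\<close>. Horner's recursion, which consumes the
  coefficient sequence from the front, makes division by a linear factor a plain induction.
\<close>
primrec horner :: "nat \<Rightarrow> (nat \<Rightarrow> 'a) \<Rightarrow> 'k \<Rightarrow> 'a" where
  "horner 0 c t = \<zero>"
| "horner (Suc m) c t = c 0 \<oplus> t \<odot> horner m (\<lambda>k. c (Suc k)) t"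

lemma horner_closed [simp, intro]:
  assumes "\<And>k. c k \<in> carrier A" "t \<in> carrier F"
  shows "horner m c t \<in> carrier A"
  using assms by (induction m arbitrary: c) auto

lemma horner_zero [simp]: "t \<in> carrier F \<Longrightarrow> horner m (\<lambda>k. \<zero>) t = \<zero>"
  by (induction m) auto

lemma horner_add:
  assumes "\<And>k. c k \<in> carrier A" "\<And>k. d k \<in> carrier A" "t \<in> carrier F"
  shows "horner m (\<lambda>k. c k \<oplus> d k) t = horner m c t \<oplus> horner m d t"
  using assms
  by (induction m arbitrary: c d) (auto simp: S.smult_r_distr a_ac)

lemma horner_mult_right:
  assumes "\<And>k. c k \<in> carrier A" "x \<in> carrier A" "t \<in> carrier F"
  shows "horner m (\<lambda>k. c k \<otimes> x) t = horner m c t \<otimes> x"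
  using assms
  by (induction m arbitrary: c) (auto simp: l_distr S.smult_assoc2)

lemma horner_top:
  assumes "\<And>k. c k \<in> carrier A" "t \<in> carrier F"
  shows "horner (Suc m) c t = horner m c t \<oplus> (t [^]\<^bsub>F\<^esub> m) \<odot> c m"
  using assms
proof (induction m arbitrary: c)
  case 0
  then show ?case by simp
next
  case (Suc m)
  have "horner (Suc (Suc m)) c t = c 0 \<oplus> t \<odot> horner (Suc m) (\<lambda>k. c (Suc k)) t"
    by simp
  also have "\<dots> = c 0 \<oplus> t \<odot> (horner m (\<lambda>k. c (Suc k)) t \<oplus> (t [^]\<^bsub>F\<^esub> m) \<odot> c (Suc m))"
    using Suc.IH[of "\<lambda>k. c (Suc k)"] Suc.prems by simp
  also have "\<dots> = horner (Suc m) c t \<oplus> (t [^]\<^bsub>F\<^esub> Suc m) \<odot> c (Suc m)"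
    using Suc.prems
    by (simp add: S.smult_r_distr a_assoc S.smult_assoc1[symmetric] F.m_comm)
  finally show ?case .
qed

text \<open>
  Synthetic division of \<open>t p(t)\<close>, with \<open>p = \<Sum>\<^sub>k\<^sub><\<^sub>m t\<^sup>k c\<^sub>k\<close>, by \<open>t - a\<close>: the quotient has as its
  coefficients the values at \<open>a\<close> of the tails of \<open>p\<close>. Stating it for \<open>t p(t)\<close> avoids a case distinction on
  the length, and it also covers \<open>c + t p(t)\<close>, because the constant cancels in the difference.
\<close>
lemma horner_factor:
  assumes "\<And>k. c k \<in> carrier A" "a \<in> carrier F" "t \<in> carrier F"
  shows "t \<odot> horner m c t \<ominus> a \<odot> horner m c a
    = (t \<ominus>\<^bsub>F\<^esub> a) \<odot> horner m (\<lambda>k. horner (m - k) (\<lambda>i. c (k + i)) a) t"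
  using assms(1)
proof (induction m arbitrary: c)
  case 0
  then show ?case using assms by (simp add: minus_eq)
next
  case (Suc m)
  define P where "P = horner m (\<lambda>k. c (Suc k)) t"
  define Q where "Q = horner m (\<lambda>k. c (Suc k)) a"
  define D where "D = horner m (\<lambda>k. horner (m - k) (\<lambda>i. c (Suc (k + i))) a) t"
  have cl: "P \<in> carrier A" "Q \<in> carrier A" "D \<in> carrier A" "c 0 \<in> carrier A"
    using Suc.prems assms by (auto simp: P_def Q_def D_def)
  have IH: "t \<odot> P \<ominus> a \<odot> Q = (t \<ominus>\<^bsub>F\<^esub> a) \<odot> D"
    using Suc.IH[of "\<lambda>k. c (Suc k)"] Suc.prems by (simp add: P_def Q_def D_def)
  have "t \<odot> horner (Suc m) c t \<ominus> a \<odot> horner (Suc m) c a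
      = t \<odot> (c 0 \<oplus> t \<odot> P) \<ominus> a \<odot> (c 0 \<oplus> a \<odot> Q)"
    by (simp add: P_def Q_def)
  also have "\<dots> = (t \<ominus>\<^bsub>F\<^esub> a) \<odot> (c 0 \<oplus> a \<odot> Q) \<oplus> t \<odot> (t \<odot> P \<ominus> a \<odot> Q)"
  proof -
    \<comment> \<open>The mixed term \<open>t \<odot> (a \<odot> Q)\<close> is added and subtracted.\<close>
    define W where "W = t \<odot> (a \<odot> Q)"
    define V where "V = \<ominus> (a \<odot> c 0) \<oplus> \<ominus> (a \<odot> (a \<odot> Q))"
    have WV: "W \<in> carrier A" "V \<in> carrier A" using cl assms by (auto simp: W_def V_def)
    have "t \<odot> (c 0 \<oplus> t \<odot> P) \<ominus> a \<odot> (c 0 \<oplus> a \<odot> Q) = t \<odot> c 0 \<oplus> t \<odot> (t \<odot> P) \<oplus> V"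
      using cl assms by (simp add: minus_eq smult_simps V_def minus_add a_ac)
    also have "\<dots> = t \<odot> c 0 \<oplus> t \<odot> (t \<odot> P) \<oplus> V \<oplus> (W \<oplus> \<ominus> W)"
      using cl assms WV by (simp add: r_neg)
    also have "\<dots> = (t \<odot> c 0 \<oplus> W \<oplus> V) \<oplus> (t \<odot> (t \<odot> P) \<oplus> \<ominus> W)"
      using cl assms WV by (simp add: a_ac)
    also have "\<dots> = (t \<ominus>\<^bsub>F\<^esub> a) \<odot> (c 0 \<oplus> a \<odot> Q) \<oplus> t \<odot> (t \<odot> P \<ominus> a \<odot> Q)"
      using cl assms by (simp add: minus_eq F.minus_eq smult_simps W_def V_def minus_add a_ac)
    finally show ?thesis .
  qed
  also have "\<dots> = (t \<ominus>\<^bsub>F\<^esub> a) \<odot> (c 0 \<oplus> a \<odot> Q \<oplus> t \<odot> D)"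
  proof -
    have ta: "t \<ominus>\<^bsub>F\<^esub> a \<in> carrier F" using assms by simp
    have "t \<odot> ((t \<ominus>\<^bsub>F\<^esub> a) \<odot> D) = (t \<ominus>\<^bsub>F\<^esub> a) \<odot> (t \<odot> D)"
      by (rule smult_comm[OF assms(3) ta cl(3)])
    then show ?thesis
      unfolding IH using S.smult_r_distr[OF ta, of "c 0 \<oplus> a \<odot> Q" "t \<odot> D"] cl assms(2,3) by simp
  qed
  finally show ?case using cl
    by (simp add: P_def Q_def D_def)
qed

text \<open>
  The usual bound on the number of roots, for coefficients in a module: subtracting the value at
  one root and dividing leaves a polynomial of smaller degree that vanishes at the other roots. The
  quotient is then zero, so all tails vanish at \<open>a\<close>; each coefficient is zero because it is the
  value of its tail minus \<open>a\<close> times the value of the next tail.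
\<close>
lemma horner_vanish:
  assumes "\<And>k. c k \<in> carrier A" "T \<subseteq> carrier F" "m \<le> card T"
    and "\<And>t. t \<in> T \<Longrightarrow> horner m c t = \<zero>"
    and "k < m"
  shows "c k = \<zero>"
  using assms
proof (induction m arbitrary: c T k)
  case 0
  then show ?case by simp
next
  case (Suc m)
  have finT: "finite T" using Suc.prems(2) F_finite finite_subset by blast
  obtain a where a: "a \<in> T" using Suc.prems(3) by fastforce
  have aF: "a \<in> carrier F" using a Suc.prems(2) by blast
  define c' where "c' = (\<lambda>k. c (Suc k))"
  have c'cl: "\<And>k. c' k \<in> carrier A" using Suc.prems(1) by (simp add: c'_def)
  define d where "d = (\<lambda>k. horner (m - k) (\<lambda>i. c' (k + i)) a)"
  have dcl: "\<And>k. d k \<in> carrier A" using c'cl aF by (auto simp: d_def)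
  have "d j = \<zero>" if "j < m" for j
  proof (rule Suc.IH[of d "T - {a}" j])
    show "T - {a} \<subseteq> carrier F" using Suc.prems(2) by blast
    show "m \<le> card (T - {a})" using Suc.prems(3) a finT by simp
    fix t assume t: "t \<in> T - {a}"
    then have tF: "t \<in> carrier F" using Suc.prems(2) by blast
    have ct: "c 0 \<in> carrier A" "horner m c' t \<in> carrier A" "horner m c' a \<in> carrier A"
      using Suc.prems(1) c'cl tF aF by auto
    have "c 0 \<oplus> t \<odot> horner m c' t = \<zero>" "c 0 \<oplus> a \<odot> horner m c' a = \<zero>"
      using Suc.prems(4)[of t] Suc.prems(4)[of a] t a by (auto simp: c'_def)
    then have "t \<odot> horner m c' t = a \<odot> horner m c' a"
      using ct tF aF minus_equality[of "t \<odot> horner m c' t" "c 0"]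
        minus_equality[of "a \<odot> horner m c' a" "c 0"] by (simp add: a_comm)
    then have "(t \<ominus>\<^bsub>F\<^esub> a) \<odot> horner m d t = \<zero>"
      using horner_factor[of c' a t m] c'cl tF aF ct by (simp add: d_def minus_eq r_neg)
    moreover have "t \<ominus>\<^bsub>F\<^esub> a \<noteq> \<zero>\<^bsub>F\<^esub>" using t tF aF by auto
    ultimately show "horner m d t = \<zero>"
      using smult_cancel[of "t \<ominus>\<^bsub>F\<^esub> a"] tF aF dcl by auto
  qed (use dcl that in auto)
  moreover have "d m = \<zero>" by (simp add: d_def)
  ultimately have d0: "d j = \<zero>" if "j \<le> m" for j
    using that by (cases "j = m") auto
  show ?case
  proof (cases k)
    case 0
    have "horner (Suc m) c a = \<zero>" using a Suc.prems(4) by blast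
    moreover have "horner m c' a = \<zero>" using d0[of 0] by (simp add: d_def)
    ultimately show ?thesis using 0 aF Suc.prems(1) by (simp add: c'_def)
  next
    case (Suc j)
    then have j: "j < m" using Suc.prems(5) by simp
    have "d j = c' j \<oplus> a \<odot> d (Suc j)"
      using j by (simp add: d_def Suc_diff_Suc[symmetric] del: Suc_diff_Suc)
    then show ?thesis using d0[of j] d0[of "Suc j"] j Suc aF Suc.prems(1) c'cl
      by (simp add: c'_def)
  qed
qed

section \<open>Powers along a line\<close>

text \<open>
  The coefficient of \<open>t\<^sup>k\<close> in \<open>(x + t z)\<^sup>n\<close> for \<open>x\<close> and \<open>z\<close> that need not commute, that is, the sum of all
  words with \<open>n - k\<close> letters \<open>x\<close> and \<open>k\<close> letters \<open>z\<close>.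
\<close>
fun line_coeff :: "'a \<Rightarrow> 'a \<Rightarrow> nat \<Rightarrow> nat \<Rightarrow> 'a" where
  "line_coeff x z 0 0 = \<one>"
| "line_coeff x z 0 (Suc k) = \<zero>"
| "line_coeff x z (Suc n) 0 = line_coeff x z n 0 \<otimes> x"
| "line_coeff x z (Suc n) (Suc k) = line_coeff x z n (Suc k) \<otimes> x \<oplus> line_coeff x z n k \<otimes> z"

context
  fixes x z assumes xz: "x \<in> carrier A" "z \<in> carrier A"
begin

lemma line_coeff_closed [simp, intro]: "line_coeff x z n k \<in> carrier A"
  using xz by (induction x z n k rule: line_coeff.induct) auto

lemma line_coeff_0: "line_coeff x z n 0 = x [^] n"
  by (induction n) auto

lemma line_coeff_beyond: "n < k \<Longrightarrow> line_coeff x z n k = \<zero>"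
  using xz by (induction x z n k rule: line_coeff.induct) auto

lemma line_coeff_top: "line_coeff x z n n = z [^] n"
  using xz by (induction n) (auto simp: line_coeff_beyond)

lemma horner_line_coeff:
  assumes "t \<in> carrier F" "n \<le> m"
  shows "horner (Suc m) (line_coeff x z n) t = (x \<oplus> t \<odot> z) [^] n"
  using assms(2)
proof (induction n arbitrary: m)
  case 0
  have "(\<lambda>k. line_coeff x z 0 (Suc k)) = (\<lambda>k. \<zero>)" by simp
  then show ?case using assms by simp
next
  case (Suc n)
  then obtain m' where m: "m = Suc m'" "n \<le> m'" by (cases m) auto
  have "horner (Suc m) (line_coeff x z (Suc n)) t
      = line_coeff x z n 0 \<otimes> x
        \<oplus> t \<odot> horner m (\<lambda>k. line_coeff x z n (Suc k) \<otimes> x \<oplus> line_coeff x z n k \<otimes> z) t"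
    by simp
  also have "\<dots> = horner (Suc m) (line_coeff x z n) t \<otimes> x \<oplus> t \<odot> (horner m (line_coeff x z n) t \<otimes> z)"
    using assms(1) xz
    by (simp add: horner_add horner_mult_right S.smult_r_distr l_distr S.smult_assoc2 a_assoc)
  also have "horner (Suc m) (line_coeff x z n) t = (x \<oplus> t \<odot> z) [^] n"
    using m by (intro Suc.IH) simp
  also have "horner m (line_coeff x z n) t = (x \<oplus> t \<odot> z) [^] n"
    unfolding m(1) using m(2) by (rule Suc.IH)
  finally show ?case
    using assms(1) xz by (simp add: r_distr S.smult_assoc3)
qed

text \<open>
  The linear coefficient is \<open>s = \<Sum>\<^sub>i x\<^sup>i z x\<^sup>n\<^sup>-\<^sup>1\<^sup>-\<^sup>i\<close>, so \<open>s x - x s\<close> telescopes to \<open>z x\<^sup>n - x\<^sup>n z\<close>. The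
  equation is written without subtraction.
\<close>
lemma line_coeff_1_commutator:
  "x \<otimes> line_coeff x z n 1 \<oplus> z \<otimes> x [^] n = line_coeff x z n 1 \<otimes> x \<oplus> x [^] n \<otimes> z"
proof (induction n)
  case 0
  then show ?case using xz by simp
next
  case (Suc n)
  define s where "s = line_coeff x z n 1"
  have s: "s \<in> carrier A" by (simp add: s_def)
  have e: "line_coeff x z (Suc n) 1 = s \<otimes> x \<oplus> x [^] n \<otimes> z"
    by (simp add: s_def line_coeff_0 One_nat_def[symmetric] del: One_nat_def)
      (simp add: line_coeff_0)
  have "x \<otimes> line_coeff x z (Suc n) 1 \<oplus> z \<otimes> x [^] Suc n
      = (x \<otimes> s \<oplus> z \<otimes> x [^] n) \<otimes> x \<oplus> x \<otimes> x [^] n \<otimes> z"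
    unfolding e using s xz by (simp add: r_distr l_distr m_assoc a_ac)
  also have "\<dots> = (s \<otimes> x \<oplus> x [^] n \<otimes> z) \<otimes> x \<oplus> x \<otimes> x [^] n \<otimes> z"
    using Suc by (simp add: s_def)
  also have "x \<otimes> x [^] n = x [^] Suc n" using xz by (metis nat_pow_Suc2)
  finally show ?case using e s xz by simp
qed

end

lemma idem_pow:
  assumes "e \<in> carrier A" "e \<otimes> e = e" "0 < k"
  shows "e [^] (k::nat) = e"
  using assms(3) by (induction k rule: nat_induct_non_zero) (use assms in auto)

text \<open>
  On a line inside \<open>I\<close> the polynomial \<open>(x + t e)\<^sup>q - x - t e\<close> vanishes for all \<open>q\<close> scalars \<open>t\<close>. Its top term
  \<open>t\<^sup>q e\<^sup>q\<close> equals \<open>t e\<close>, which cancels \<open>- t e\<close> and lowers the degree below \<open>q\<close>.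
\<close>
lemma line_in_I_line_coeff:
  assumes x: "x \<in> carrier A" and e: "e \<in> carrier A" "e \<otimes> e = e"
    and line: "\<And>t. t \<in> carrier F \<Longrightarrow> x \<oplus> t \<odot> e \<in> I_set A q"
    and k: "0 < k" "k < q"
  shows "line_coeff x e q k = \<zero>"
proof -
  obtain r where r: "q = Suc (Suc r)" using q_ge_2 by (metis add_2_eq_Suc le_Suc_ex)
  define s where "s = line_coeff x e q"
  have scl: "s k \<in> carrier A" for k using x e by (simp add: s_def)
  define d where "d = (\<lambda>k::nat. if k = 0 then \<ominus> x else \<zero>)"
  have dcl: "d k \<in> carrier A" for k using x e by (simp add: d_def)
  \<comment> \<open>The sequence \<open>d\<close> subtracts the constant term \<open>x\<close>.\<close>
  have "horner q (\<lambda>k. s k \<oplus> d k) t = \<zero>" if t: "t \<in> carrier F" for t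
  proof -
    have "x \<oplus> t \<odot> e = (x \<oplus> t \<odot> e) [^] q" using line[OF t] by (simp add: I_set_def)
    also have "\<dots> = horner (Suc q) s t" using horner_line_coeff[OF x e(1) t order_refl]
      by (simp add: s_def)
    also have "\<dots> = horner q s t \<oplus> (t [^]\<^bsub>F\<^esub> q) \<odot> s q" by (rule horner_top[OF scl t])
    also have "(t [^]\<^bsub>F\<^esub> q) \<odot> s q = t \<odot> e"
      using x e t q_ge_2 by (simp add: scalar_pow_q s_def line_coeff_top idem_pow)
    finally have "x = horner q s t" using x e t scl by simp
    moreover have "horner q d t = \<ominus> x" using t x by (simp add: r d_def)
    ultimately show ?thesis using horner_add[OF scl dcl t] x by (simp add: r_neg)
  qed
  then have "s k \<oplus> d k = \<zero>"
    using k horner_vanish[of "\<lambda>k. s k \<oplus> d k" "carrier F" q k]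
    by (simp add: scl dcl F_card)
  then show ?thesis using scl k by (simp add: d_def s_def)
qed

text \<open>
  The vanishing of the linear coefficient, combined with \<open>x\<^sup>q = x\<close>, turns the telescoping identity into
  \<open>e x = x e\<close>.
\<close>
lemma line_in_I_commutes:
  assumes x: "x \<in> carrier A" and e: "e \<in> carrier A" "e \<otimes> e = e"
    and line: "\<And>t. t \<in> carrier F \<Longrightarrow> x \<oplus> t \<odot> e \<in> I_set A q"
  shows "x \<otimes> e = e \<otimes> x"
proof -
  have "line_coeff x e q 1 = \<zero>"
    using line_in_I_line_coeff[OF assms, of 1] q_ge_2 by simp
  moreover have "x [^] q = x" using line[of "\<zero>\<^bsub>F\<^esub>"] x e by (simp add: I_set_def)
  ultimately show ?thesis using line_coeff_1_commutator[OF x e(1), of q] x e by simp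
qed

lemma smult_pow:
  assumes "t \<in> carrier F" "x \<in> carrier A"
  shows "(t \<odot> x) [^] (n::nat) = (t [^]\<^bsub>F\<^esub> n) \<odot> x [^] n"
  using assms
  by (induction n) (simp_all add: S.smult_assoc1 S.smult_assoc2 S.smult_assoc3 smult_comm F.m_comm)

text \<open>
  Since \<open>1\<close> commutes with \<open>x\<close>, the coefficients of \<open>(x + t)\<^sup>n\<close> are powers of \<open>x\<close> times the binomial coefficients,
  which appear here as the coefficients of \<open>(1 + t)\<^sup>n\<close>.
\<close>
lemma line_coeff_one:
  assumes "x \<in> carrier A" "k \<le> n"
  shows "line_coeff x \<one> n k = line_coeff \<one> \<one> n k \<otimes> x [^] (n - k)"
  using assms(2)
proof (induction n arbitrary: k)
  case 0
  then show ?case by simp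
next
  case (Suc n)
  show ?case
  proof (cases k)
    case 0
    then show ?thesis using assms(1) by (simp add: line_coeff_0)
  next
    case (Suc j)
    show ?thesis
    proof (cases "j = n")
      case True
      then show ?thesis using Suc Suc.IH[of n] assms(1)
        by (simp add: line_coeff_beyond line_coeff_top)
    next
      case False
      then have "n - j = Suc (n - Suc j)" using Suc Suc.prems by simp
      then have "x [^] (n - j) = x [^] (n - Suc j) \<otimes> x" by simp
      then show ?thesis using Suc Suc.IH[of "Suc j"] Suc.IH[of j] Suc.prems False assms(1)
        by (simp add: l_distr m_assoc)
    qed
  qed
qed

lemma horner_const:
  assumes "\<And>k. c k \<in> carrier A" "t \<in> carrier F" "\<And>k. 0 < k \<Longrightarrow> k \<le> m \<Longrightarrow> c k = \<zero>"
  shows "horner (Suc m) c t = c 0"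
  using assms(3)
proof (induction m)
  case 0
  then show ?case using assms by simp
next
  case (Suc m)
  then show ?case using horner_top[of c t "Suc m"] assms by simp
qed

text \<open>
  The line \<open>1 + t\<close> consists of scalars and so lies in \<open>I\<close>. Hence the intermediate binomial coefficients
  of exponent \<open>q\<close> vanish, which gives additivity of the \<open>q\<close>-th power in the direction of \<open>1\<close>.
\<close>
lemma add_scalar_pow_q:
  assumes x: "x \<in> carrier A" and t: "t \<in> carrier F"
  shows "(x \<oplus> t \<odot> \<one>) [^] q = x [^] q \<oplus> t \<odot> \<one>"
proof -
  obtain m where m: "q = Suc m" using q_ge_2 by (cases q) auto
  have "\<one> \<oplus> s \<odot> \<one> \<in> I_set A q" if s: "s \<in> carrier F" for s
  proof -
    have "(\<one> \<oplus> s \<odot> \<one>) = (\<one>\<^bsub>F\<^esub> \<oplus>\<^bsub>F\<^esub> s) \<odot> \<one>" using s by (simp add: S.smult_l_distr)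
    then show ?thesis using s by (simp add: I_set_def smult_pow scalar_pow_q)
  qed
  then have one: "line_coeff \<one> \<one> q k = \<zero>" if "0 < k" "k < q" for k
    using line_in_I_line_coeff[of \<one> \<one> k] that by simp
  have cl: "line_coeff x \<one> q k \<in> carrier A" for k using x by simp
  have "(x \<oplus> t \<odot> \<one>) [^] q = horner (Suc q) (line_coeff x \<one> q) t"
    using horner_line_coeff[OF x one_closed t order_refl] by simp
  also have "\<dots> = horner (Suc m) (line_coeff x \<one> q) t \<oplus> (t [^]\<^bsub>F\<^esub> q) \<odot> line_coeff x \<one> q q"
    unfolding m[symmetric] by (rule horner_top[OF cl t])
  also have "horner (Suc m) (line_coeff x \<one> q) t = line_coeff x \<one> q 0"
    using one line_coeff_one[OF x, of _ q] x by (intro horner_const[OF cl t]) (simp add: m)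
  finally show ?thesis using x t by (simp add: scalar_pow_q line_coeff_top line_coeff_0)
qed

section \<open>Idempotents and square-zero elements\<close>

definition centralizer :: "'a \<Rightarrow> 'a set" where
  "centralizer x = {y \<in> carrier A. y \<otimes> x = x \<otimes> y}"

text \<open>
  For idempotents \<open>h\<close> and \<open>k\<close> this is the Peirce component \<open>h A k\<close>, described by the equations that its
  elements satisfy.
\<close>
definition peirce :: "'a \<Rightarrow> 'a \<Rightarrow> 'a set" where
  "peirce h k = {x \<in> carrier A. h \<otimes> x = x \<and> x \<otimes> k = x}"

lemma peirceD:
  assumes "x \<in> peirce h k"
  shows "x \<in> carrier A" "h \<otimes> x = x" "x \<otimes> k = x"
  using assms by (auto simp: peirce_def)

lemma I_set_sub: "I_set A q \<subseteq> carrier A"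
  by (auto simp: I_set_def)

lemma finite_subsets [simp]: "X \<subseteq> carrier A \<Longrightarrow> finite X"
  using A_finite finite_subset by blast

lemma I_setD_pow_idem:
  assumes "y \<in> I_set A q"
  shows "y [^] (q - 1) \<otimes> y = y" "y [^] (q - 1) \<otimes> y [^] (q - 1) = y [^] (q - 1)"
proof -
  obtain r where r: "q = Suc (Suc r)" using q_ge_2 by (metis add_2_eq_Suc le_Suc_ex)
  have y: "y \<in> carrier A" "y [^] q = y" using assms by (auto simp: I_set_def)
  show "y [^] (q - 1) \<otimes> y = y" using y by (simp add: r)
  have "y [^] (q - 1) \<otimes> y [^] (q - 1) = y [^] (q + r)"
  proof -
    have "q - 1 + (q - 1) = q + r" by (simp add: r)
    then show ?thesis using nat_pow_mult[OF y(1), of "q - 1" "q - 1"] by simp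
  qed
  also have "\<dots> = y [^] q \<otimes> y [^] r" using nat_pow_mult[OF y(1), of q r] by simp
  also have "\<dots> = y [^] (q - 1)" using y nat_pow_Suc2[OF y(1), of r] by (simp only: r) simp
  finally show "y [^] (q - 1) \<otimes> y [^] (q - 1) = y [^] (q - 1)" .
qed

text \<open>
  Suppose that \<open>x\<close> in \<open>I\<close> is not a scalar. Then \<open>(x + t)\<^sup>q\<^sup>-\<^sup>1\<close> is a nonzero idempotent for every scalar \<open>t\<close>,
  hence equal to \<open>1\<close>. But \<open>(x + t)\<^sup>q\<^sup>-\<^sup>1 - 1\<close> is a polynomial in \<open>t\<close> of degree below \<open>q\<close> with leading coefficient \<open>1\<close>, and
  it cannot vanish at all \<open>q\<close> scalars.
\<close>
lemma I_set_scalar_of_trivial_idempotents: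
  assumes idem: "\<And>g. g \<in> carrier A \<Longrightarrow> g \<otimes> g = g \<Longrightarrow> g = \<zero> \<or> g = \<one>"
    and x: "x \<in> I_set A q"
  shows "x \<in> (\<lambda>t. t \<odot> \<one>) ` carrier F"
proof (rule ccontr)
  assume no: "x \<notin> (\<lambda>t. t \<odot> \<one>) ` carrier F"
  have xc: "x \<in> carrier A" "x [^] q = x" using x by (auto simp: I_set_def)
  obtain r where r: "q = Suc (Suc r)" using q_ge_2 by (metis add_2_eq_Suc le_Suc_ex)
  define s where "s = line_coeff x \<one> (q - 1)"
  have scl: "s k \<in> carrier A" for k using xc by (simp add: s_def)
  define d where "d = (\<lambda>k::nat. if k = 0 then \<ominus> \<one> else \<zero>)"
  have dcl: "d k \<in> carrier A" for k by (simp add: d_def)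
  \<comment> \<open>The sequence \<open>d\<close> subtracts the constant \<open>1\<close>.\<close>
  have "horner q (\<lambda>k. s k \<oplus> d k) t = \<zero>" if t: "t \<in> carrier F" for t
  proof -
    define y where "y = x \<oplus> t \<odot> \<one>"
    have yc: "y \<in> carrier A" using xc t by (simp add: y_def)
    have yI: "y \<in> I_set A q"
      using xc t add_scalar_pow_q[OF xc(1) t] by (simp add: I_set_def y_def)
    have "y \<noteq> \<zero>"
    proof
      assume "y = \<zero>"
      then have "x = \<ominus> (t \<odot> \<one>)"
        using minus_equality[of x "t \<odot> \<one>"] xc t by (simp add: y_def)
      then have "x = (\<ominus>\<^bsub>F\<^esub> t) \<odot> \<one>" using t by (simp add: S.smult_l_minus)
      then show False using no t by blast
    qed
    then have "y [^] (q - 1) \<noteq> \<zero>" using I_setD_pow_idem(1)[OF yI] yc by auto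
    then have "y [^] (q - 1) = \<one>" using idem I_setD_pow_idem(2)[OF yI] yc by blast
    moreover have "horner q s t = y [^] (q - 1)"
      using horner_line_coeff[OF xc(1) one_closed t, of "q - 1" "q - 1"] q_ge_2
      by (simp add: s_def y_def)
    moreover have "horner q d t = \<ominus> \<one>" using t by (simp add: r d_def)
    ultimately show ?thesis using horner_add[OF scl dcl t] by (simp add: r_neg)
  qed
  then have "s (q - 1) \<oplus> d (q - 1) = \<zero>"
    using horner_vanish[of "\<lambda>k. s k \<oplus> d k" "carrier F" q "q - 1"] q_ge_2
    by (simp add: scl dcl F_card)
  then have "\<one> = \<zero>"
    using q_ge_2 xc by (simp add: s_def d_def line_coeff_top)
  then have "x = \<zero>\<^bsub>F\<^esub> \<odot> \<one>" using xc by (metis l_one l_null S.smult_l_null one_closed)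
  then show False using no by blast
qed

text \<open>
  The sum of \<open>C(e)\<close>, \<open>e A f\<close> and \<open>f A e\<close> is direct, because \<open>e _ f\<close> and \<open>f _ e\<close> recover the off-diagonal
  parts and kill everything that commutes with \<open>e\<close>.
\<close>
lemma card_peirce:
  assumes e: "e \<in> carrier A" "e \<otimes> e = e" and f: "f = \<one> \<ominus> e"
  shows "card (centralizer e) * (card (peirce e f) * card (peirce f e)) \<le> card (carrier A)"
proof -
  have fc: "f \<in> carrier A" using e f by simp
  have ef: "e \<otimes> f = \<zero>" "f \<otimes> e = \<zero>" "f \<otimes> f = f"
    using e by (simp_all add: f minus_eq r_distr l_distr r_minus l_minus r_neg l_neg)
  let ?X = "centralizer e \<times> (peirce e f \<times> peirce f e)"
  let ?g = "\<lambda>(c, u, v). c \<oplus> u \<oplus> v"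
  have parts: "e \<otimes> (c \<oplus> u \<oplus> v) \<otimes> f = u" "f \<otimes> (c \<oplus> u \<oplus> v) \<otimes> e = v"
    if c: "c \<in> carrier A" "c \<otimes> e = e \<otimes> c" and u: "u \<in> peirce e f" and v: "v \<in> peirce f e" for c u v
  proof -
    note u' = peirceD[OF u] and v' = peirceD[OF v]
    have cef: "e \<otimes> c \<otimes> f = \<zero>" using c e fc ef by (metis m_assoc r_null)
    have cfe: "f \<otimes> c \<otimes> e = \<zero>" using c e fc ef by (metis m_assoc l_null)
    have 1: "e \<otimes> v = \<zero>" using e fc ef v' by (metis m_assoc l_null)
    have 2: "f \<otimes> u = \<zero>" using e fc ef u' by (metis m_assoc l_null)
    show "e \<otimes> (c \<oplus> u \<oplus> v) \<otimes> f = u" using c u' v' e fc cef 1 by (simp add: r_distr l_distr)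
    show "f \<otimes> (c \<oplus> u \<oplus> v) \<otimes> e = v" using c u' v' e fc cfe 2 by (simp add: r_distr l_distr)
  qed
  have "inj_on ?g ?X"
  proof (rule inj_onI, clarsimp)
    fix c u v c' u' v'
    assume c: "c \<in> centralizer e" "c' \<in> centralizer e"
      and u: "u \<in> peirce e f" "u' \<in> peirce e f" and v: "v \<in> peirce f e" "v' \<in> peirce f e"
      and eq: "c \<oplus> u \<oplus> v = c' \<oplus> u' \<oplus> v'"
    have c': "c \<in> carrier A" "c \<otimes> e = e \<otimes> c" "c' \<in> carrier A" "c' \<otimes> e = e \<otimes> c'"
      using c by (auto simp: centralizer_def)
    have "u = u'" using parts(1)[OF c'(1,2) u(1) v(1)] parts(1)[OF c'(3,4) u(2) v(2)] eq by simp
    moreover have "v = v'" using parts(2)[OF c'(1,2) u(1) v(1)] parts(2)[OF c'(3,4) u(2) v(2)] eq by simp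
    ultimately show "c = c' \<and> u = u' \<and> v = v'"
      using eq c' peirceD(1)[OF u(1)] peirceD(1)[OF v(1)] by simp
  qed
  moreover have "?g ` ?X \<subseteq> carrier A"
    by (auto simp: centralizer_def peirce_def)
  ultimately have "card ?X \<le> card (carrier A)"
    using A_finite card_inj_on_le by blast
  then show ?thesis by (simp add: card_cartesian_product)
qed

text \<open>
  The binomial expansion stops after the linear term because \<open>n\<^sup>2 = 0\<close>.
\<close>
lemma add_nilpotent_pow:
  assumes y: "y \<in> carrier A" and n: "n \<in> carrier A" "n \<otimes> n = \<zero>" "y \<otimes> n = n \<otimes> y"
  shows "(y \<oplus> n) [^] Suc k = y [^] Suc k \<oplus> [Suc k] \<cdot> (y [^] k \<otimes> n)"
proof (induction k)
  case 0
  then show ?case using y n by simp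
next
  case (Suc k)
  have 1: "y [^] k \<otimes> n \<otimes> y = y [^] Suc k \<otimes> n" using y n by (simp add: m_assoc)
  have 2: "y [^] k \<otimes> n \<otimes> n = \<zero>" using y n by (simp add: m_assoc)
  have "(y \<oplus> n) [^] Suc (Suc k) = (y [^] Suc k \<oplus> [Suc k] \<cdot> (y [^] k \<otimes> n)) \<otimes> (y \<oplus> n)"
    using Suc by (metis nat_pow_Suc)
  also have "\<dots> = y [^] Suc (Suc k) \<oplus> (y [^] Suc k \<otimes> n \<oplus> [Suc k] \<cdot> (y [^] Suc k \<otimes> n))"
    using y n 1 2
    by (simp add: r_distr l_distr add_pow_ldistr a_assoc del: nat_pow_Suc add.nat_pow_Suc)
      (simp add: a_ac)
  finally show ?case using y n by (simp add: a_ac)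
qed

lemma add_nilpotent_pow_q:
  assumes "y \<in> carrier A" "n \<in> carrier A" "n \<otimes> n = \<zero>" "y \<otimes> n = n \<otimes> y"
  shows "(y \<oplus> n) [^] q = y [^] q"
proof -
  obtain k where k: "q = Suc k" using q_ge_2 by (cases q) auto
  show ?thesis
    using add_nilpotent_pow[OF assms, of k] add_pow_q_eq_zero[of "y [^] k \<otimes> n"] assms
    unfolding k by simp
qed

text \<open>
  The equation \<open>y h = a\<close> makes \<open>y\<close> block triangular with diagonal block \<open>a\<close> at \<open>h\<close>, so the corresponding
  block of \<open>y\<^sup>q\<close> is \<open>a\<^sup>q\<close>.
\<close>
lemma corner_in_I:
  assumes h: "h \<in> carrier A" and a: "a \<in> peirce h h"
    and y: "y \<in> carrier A" "y \<otimes> h = a" "h \<otimes> (y [^] q \<otimes> h) = a"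
  shows "a \<in> I_set A q"
proof -
  note a' = peirceD[OF a]
  have pow: "y [^] k \<otimes> h = a [^] k \<otimes> h" for k :: nat
  proof (induction k)
    case 0
    then show ?case using h by simp
  next
    case (Suc k)
    have "y [^] Suc k \<otimes> h = y [^] k \<otimes> (h \<otimes> a)" using h y a' by (simp add: m_assoc)
    also have "\<dots> = (a [^] k \<otimes> h) \<otimes> a"
      using y h a' m_assoc[of "y [^] k" h a] by (simp flip: Suc)
    also have "\<dots> = a [^] Suc k \<otimes> h" using h a' by (simp add: m_assoc)
    finally show ?case .
  qed
  obtain k where k: "q = Suc k" using q_ge_2 by (cases q) auto
  have "a [^] q \<otimes> h = a [^] q" using a' h by (simp add: k m_assoc)
  moreover have "h \<otimes> a [^] q = a [^] q"
    using a' h nat_pow_Suc2[OF a'(1), of k] by (simp add: k m_assoc[symmetric] del: nat_pow_Suc)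
  ultimately have "a [^] q = a" using y(3) pow[of q] by simp
  then show ?thesis using a' by (simp add: I_set_def)
qed

lemma I_set_square_zero:
  assumes "u \<in> I_set A q" "u \<otimes> u = \<zero>"
  shows "u = \<zero>"
proof -
  obtain r where r: "q = Suc (Suc r)" using q_ge_2 by (metis add_2_eq_Suc le_Suc_ex)
  have u: "u \<in> carrier A" "u [^] q = u" using assms by (auto simp: I_set_def)
  have "u [^] q = u [^] r \<otimes> (u \<otimes> u)" using u(1) by (simp add: r m_assoc)
  then show ?thesis using u assms by simp
qed

text \<open>
  The idempotent is \<open>g = a\<^sup>q\<^sup>-\<^sup>1\<close>. For \<open>x\<close> in the corner, \<open>g x - g x g\<close> and \<open>x g - g x g\<close> have square zero and lie in
  \<open>I\<close>, so they vanish and \<open>g\<close> commutes with \<open>x\<close>. The factor \<open>c\<close> serves to pass from \<open>a n = 0\<close> or \<open>n a = 0\<close> to the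
  same equation for \<open>g\<close>.
\<close>
lemma corner_idempotent:
  assumes h: "h \<in> carrier A" and I: "peirce h h \<subseteq> I_set A q"
    and a: "a \<in> peirce h h" "a \<noteq> \<zero>"
  obtains g c where "g \<in> peirce h h" "g \<otimes> g = g" "g \<noteq> \<zero>"
    "\<And>x. x \<in> peirce h h \<Longrightarrow> g \<otimes> x = x \<otimes> g"
    "c \<in> carrier A" "g = c \<otimes> a" "g = a \<otimes> c"
proof -
  obtain r where r: "q = Suc (Suc r)" using q_ge_2 by (metis add_2_eq_Suc le_Suc_ex)
  note a' = peirceD[OF a(1)]
  define g where "g = a [^] (q - 1)"
  define c where "c = a [^] r"
  have c: "c \<in> carrier A" using a' by (simp add: c_def)
  have gca: "g = c \<otimes> a" using r by (simp add: g_def c_def)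
  have gac: "g = a \<otimes> c" using r nat_pow_Suc2[OF a'(1), of r] by (simp add: g_def c_def)
  have gc: "g \<in> carrier A" using gca c a' by simp
  have "h \<otimes> g = g" using gac a' c h by (metis m_assoc)
  moreover have gh: "g \<otimes> h = g" using gca a' c h by (metis m_assoc)
  ultimately have g: "g \<in> peirce h h" using gc by (simp add: peirce_def)
  have aI: "a \<in> I_set A q" using I a by blast
  have gg: "g \<otimes> g = g" using I_setD_pow_idem(2)[OF aI] by (simp add: g_def)
  have "g \<otimes> a = a" using I_setD_pow_idem(1)[OF aI] by (simp add: g_def)
  then have g0: "g \<noteq> \<zero>" using a(2) a' by auto
  have comm: "g \<otimes> x = x \<otimes> g" if x: "x \<in> peirce h h" for x
  proof -
    note x' = peirceD[OF x]
    have gx: "g \<otimes> (g \<otimes> y) = g \<otimes> y" if "y \<in> carrier A" for y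
      using gg gc that by (metis m_assoc)
    have hg: "h \<otimes> g = g" using peirceD(2)[OF g] .
    define u where "u = g \<otimes> x \<ominus> g \<otimes> x \<otimes> g"
    define v where "v = x \<otimes> g \<ominus> g \<otimes> x \<otimes> g"
    have uc: "u \<in> carrier A" and vc: "v \<in> carrier A" using gc x' by (auto simp: u_def v_def)
    have "u \<in> peirce h h" "v \<in> peirce h h"
      using uc vc gc x' h gh hg
      unfolding peirce_def u_def v_def
      by (auto simp: minus_eq r_distr l_distr r_minus l_minus m_assoc)
        (simp_all add: m_assoc[symmetric])
    then have "u \<in> I_set A q" "v \<in> I_set A q" using I by auto
    moreover have "u \<otimes> u = \<zero>"
    proof -
      have "u \<otimes> g = \<zero>" using gc x' gg by (simp add: u_def minus_eq l_distr l_minus m_assoc r_neg)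
      moreover have "g \<otimes> u = u" using gc x' gx by (simp add: u_def minus_eq r_distr r_minus m_assoc)
      ultimately show ?thesis using uc gc by (metis m_assoc l_null)
    qed
    moreover have "v \<otimes> v = \<zero>"
    proof -
      have "g \<otimes> v = \<zero>" using gc x' gx by (simp add: v_def minus_eq r_distr r_minus m_assoc r_neg)
      moreover have "v \<otimes> g = v" using gc x' gg by (simp add: v_def minus_eq l_distr l_minus m_assoc)
      ultimately show ?thesis using vc gc by (metis m_assoc r_null)
    qed
    ultimately have "u = \<zero>" "v = \<zero>" by (auto intro: I_set_square_zero)
    then have "g \<otimes> x = g \<otimes> x \<otimes> g" "x \<otimes> g = g \<otimes> x \<otimes> g"
      using gc x' by (auto simp: u_def v_def)
    then show ?thesis by simp
  qed
  show thesis by (rule that[OF g gg g0 comm c gca gac])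
qed

end

section \<open>Counting along an idempotent\<close>

text \<open>
  The density hypothesis is stated as an equation between natural numbers, and indecomposability as
  a condition on central idempotents: these are the forms in which both enter the arguments.
\<close>
locale dense_algebra = finite_algebra A F q
  for A :: "('k, 'a, 'm) module_scheme" (structure) and F :: "('k, 'c) ring_scheme" (structure)
    and q :: nat +
  assumes card_complement: "q\<^sup>2 * card (carrier A - I_set A q) = (q - 1) * card (carrier A)"
    and central_idempotent: "\<And>g. g \<in> carrier A \<Longrightarrow> g \<otimes> g = g \<Longrightarrow>
      (\<And>x. x \<in> carrier A \<Longrightarrow> g \<otimes> x = x \<otimes> g) \<Longrightarrow> g = \<zero> \<or> g = \<one>"
begin

lemma card_A_pos: "0 < card (carrier A)"
  using A_finite zero_closed by (auto simp: card_gt_0_iff)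

text \<open>
  A union bound: outside \<open>C(e)\<close> some translate \<open>x + t e\<close> leaves \<open>I\<close>, so \<open>x\<close> belongs to one of \<open>q\<close>
  translates of the complement of \<open>I\<close>. Together these have density at most \<open>q (q - 1)/q\<^sup>2 = 1 - 1/q\<close>.
\<close>
lemma card_centralizer_idempotent:
  assumes e: "e \<in> carrier A" "e \<otimes> e = e"
  shows "card (carrier A) \<le> q * card (centralizer e)"
proof -
  let ?N = "carrier A - I_set A q"
  let ?B = "\<lambda>t. (\<lambda>z. z \<ominus> t \<odot> e) ` ?N"
  have "carrier A \<subseteq> centralizer e \<union> (\<Union>t\<in>carrier F. ?B t)"
  proof
    fix x assume x: "x \<in> carrier A"
    show "x \<in> centralizer e \<union> (\<Union>t\<in>carrier F. ?B t)"
    proof (cases "\<forall>t\<in>carrier F. x \<oplus> t \<odot> e \<in> I_set A q")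
      case True
      then have "x \<otimes> e = e \<otimes> x" by (intro line_in_I_commutes[OF x e]) auto
      then show ?thesis using x by (simp add: centralizer_def)
    next
      case False
      then obtain t where t: "t \<in> carrier F" "x \<oplus> t \<odot> e \<notin> I_set A q" by blast
      moreover have "x = (x \<oplus> t \<odot> e) \<ominus> t \<odot> e"
        using x e t by (simp add: minus_eq a_assoc r_neg)
      ultimately have "x \<in> ?B t" using x e by blast
      then show ?thesis using t by blast
    qed
  qed
  then have "card (carrier A) \<le> card (centralizer e \<union> (\<Union>t\<in>carrier F. ?B t))"
    by (intro card_mono) (auto simp: centralizer_def F_finite A_finite)
  also have "\<dots> \<le> card (centralizer e) + card (\<Union>t\<in>carrier F. ?B t)" by (rule card_Un_le)
  also have "card (\<Union>t\<in>carrier F. ?B t) \<le> (\<Sum>t\<in>carrier F. card (?B t))"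
    by (rule card_UN_le[OF F_finite])
  also have "\<dots> \<le> (\<Sum>t\<in>carrier F. card ?N)"
    by (intro sum_mono card_image_le) (simp add: A_finite)
  also have "\<dots> = q * card ?N" by (simp add: F_card)
  finally have "q * card (carrier A) \<le> q * (card (centralizer e) + q * card ?N)"
    by simp
  also have "\<dots> = q * card (centralizer e) + q\<^sup>2 * card ?N"
    by (simp add: algebra_simps power2_eq_square)
  finally have "q * card (carrier A) \<le> q * card (centralizer e) + q\<^sup>2 * card ?N" .
  then have "q * card (carrier A) \<le> q * card (centralizer e) + (q - 1) * card (carrier A)"
    by (simp add: card_complement)
  moreover have "q * card (carrier A) = (q - 1) * card (carrier A) + card (carrier A)"
    using q_ge_2 by (cases q) auto
  ultimately show ?thesis by linarith
qed

text \<open>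
  Otherwise every idempotent is central, hence \<open>0\<close> or \<open>1\<close>, and \<open>I\<close> consists of scalars, so \<open>|I| \<le> q\<close>. The density equation \<open>q\<^sup>2 (N - |I|) = (q - 1) N\<close> implies \<open>q\<^sup>2 | N\<close>, and with
  \<open>N = q\<^sup>2 k\<close> it becomes \<open>|I| = (q\<^sup>2 - q + 1) k\<close>, which exceeds \<open>q\<close>.
\<close>
lemma exists_noncentral_idempotent:
  obtains e where "e \<in> carrier A" "e \<otimes> e = e" "centralizer e \<noteq> carrier A"
proof (rule ccontr)
  assume no: "\<not> thesis"
  have all: "centralizer g = carrier A" if "g \<in> carrier A" "g \<otimes> g = g" for g
    using no \<open>\<And>e. e \<in> carrier A \<Longrightarrow> e \<otimes> e = e \<Longrightarrow> centralizer e \<noteq> carrier A \<Longrightarrow> thesis\<close> that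
    by blast
  have "g = \<zero> \<or> g = \<one>" if g: "g \<in> carrier A" "g \<otimes> g = g" for g
  proof (rule central_idempotent[OF g])
    show "g \<otimes> x = x \<otimes> g" if "x \<in> carrier A" for x
    proof -
      have "x \<in> centralizer g" using all[OF g] that by simp
      then show ?thesis by (simp add: centralizer_def)
    qed
  qed
  then have "I_set A q \<subseteq> (\<lambda>t. t \<odot> \<one>) ` carrier F"
    using I_set_scalar_of_trivial_idempotents by blast
  then have I: "card (I_set A q) \<le> q"
    using F_finite F_card by (metis surj_card_le)
  define N where "N = card (carrier A)"
  define i where "i = card (I_set A q)"
  have iN: "i \<le> N" unfolding i_def N_def by (intro card_mono A_finite I_set_sub)
  have "card (carrier A - I_set A q) = N - i"
    unfolding N_def i_def by (intro card_Diff_subset finite_subsets I_set_sub)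
  then have "q\<^sup>2 * (N - i) = (q - 1) * N" using card_complement by (simp add: N_def)
  moreover have "q\<^sup>2 * N = q\<^sup>2 * i + q\<^sup>2 * (N - i)"
    using iN by (metis add_mult_distrib2 le_add_diff_inverse)
  ultimately have eq: "q\<^sup>2 * N = q\<^sup>2 * i + (q - 1) * N" by simp
  have "coprime (q\<^sup>2) (q - 1)"
    using coprime_diff_one_right_nat[of q] q_ge_2 by simp
  moreover have "q\<^sup>2 dvd (q - 1) * N"
    using eq by (metis dvd_add_right_iff dvd_triv_left)
  ultimately have "q\<^sup>2 dvd N" using coprime_dvd_mult_right_iff by blast
  then obtain k where k: "N = q\<^sup>2 * k" by (rule dvdE)
  have k0: "0 < k" using card_A_pos k unfolding N_def[symmetric] by (cases k) auto
  have "q\<^sup>2 * (q\<^sup>2 * k) = q\<^sup>2 * (i + (q - 1) * k)" using eq k by (simp add: algebra_simps)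
  then have "q\<^sup>2 * k = i + (q - 1) * k"
    by (rule nat_mult_eq_cancel1[THEN iffD1, rotated]) (use q_ge_2 in simp)
  moreover have "q\<^sup>2 * k = q * k + (q * (q - 1)) * k"
    using q_ge_2 by (cases q) (auto simp: power2_eq_square algebra_simps)
  moreover have "q * k = k + (q - 1) * k" using q_ge_2 by (cases q) auto
  ultimately have "q * (q - 1) * k < q" using I k0 unfolding i_def by linarith
  moreover have "q * 1 * 1 \<le> q * (q - 1) * k"
    using q_ge_2 k0 by (intro mult_le_mono) auto
  ultimately show False by simp
qed

text \<open>
  An idempotent \<open>e\<close> that does not commute with \<open>x\<close> has \<open>e x (1 - e) \<noteq> 0\<close> or \<open>(1 - e) x e \<noteq> 0\<close>. In the second
  case the idempotent \<open>1 - e\<close> does what is required.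
\<close>
lemma exists_peirce_arrow:
  obtains e n where "e \<in> carrier A" "e \<otimes> e = e" "n \<in> peirce e (\<one> \<ominus> e)" "n \<noteq> \<zero>"
proof -
  obtain e where e: "e \<in> carrier A" "e \<otimes> e = e" "centralizer e \<noteq> carrier A"
    by (rule exists_noncentral_idempotent)
  then obtain x where x: "x \<in> carrier A" "x \<otimes> e \<noteq> e \<otimes> x"
    by (auto simp: centralizer_def)
  define f where "f = \<one> \<ominus> e"
  have f: "f \<in> carrier A" "f \<otimes> f = f" using e(1,2)
    by (simp_all add: f_def minus_eq r_distr l_distr r_minus l_minus r_neg l_neg)
  have ff: "\<one> \<ominus> f = e" using e by (simp add: f_def minus_eq minus_add r_neg2)
  show thesis
  proof (cases "e \<otimes> x \<otimes> f = \<zero>")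
    case False
    moreover have "e \<otimes> x \<otimes> f \<in> peirce e f"
      unfolding peirce_def using e f x by (simp add: m_assoc) (simp add: m_assoc[symmetric])
    ultimately show thesis using that[OF e(1,2)] by (simp add: f_def)
  next
    case True
    moreover have "e \<otimes> x \<otimes> f = e \<otimes> x \<ominus> e \<otimes> x \<otimes> e"
      using e(1) x(1) by (simp add: f_def minus_eq r_distr r_minus)
    ultimately have 1: "e \<otimes> x = e \<otimes> x \<otimes> e"
      using e(1) x(1) r_right_minus_eq[of "e \<otimes> x" "e \<otimes> x \<otimes> e"] by simp
    have "f \<otimes> x \<otimes> e \<noteq> \<zero>"
    proof
      assume "f \<otimes> x \<otimes> e = \<zero>"
      moreover have "f \<otimes> x \<otimes> e = x \<otimes> e \<ominus> e \<otimes> x \<otimes> e"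
        using e(1) x(1) by (simp add: f_def minus_eq l_distr l_minus)
      ultimately have "x \<otimes> e = e \<otimes> x \<otimes> e"
        using e(1) x(1) r_right_minus_eq[of "x \<otimes> e" "e \<otimes> x \<otimes> e"] by simp
      then show False using 1 x(2) by metis
    qed
    moreover have "f \<otimes> x \<otimes> e \<in> peirce f e"
      unfolding peirce_def using e f x by (simp add: m_assoc) (simp add: m_assoc[symmetric])
    ultimately show thesis using that[OF f] by (simp add: ff)
  qed
qed

end

section \<open>Counting along a square-zero element\<close>

text \<open>
  The element \<open>n\<close> is called an arrow because it leads from one of the two idempotents to the
  other, as in the path algebra of a quiver with two vertices.
\<close>
locale arrow_algebra = dense_algebra A F q
  for A :: "('k, 'a, 'm) module_scheme" (structure) and F :: "('k, 'c) ring_scheme" (structure)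
    and q :: nat +
  fixes e f n
  assumes e [simp]: "e \<in> carrier A" and ee [simp]: "e \<otimes> e = e"
    and f_eq: "f = \<one> \<ominus> e"
    and n: "n \<in> peirce e f" and n_nonzero: "n \<noteq> \<zero>"
begin

lemma f [simp]: "f \<in> carrier A" by (simp add: f_eq)

lemma n_closed [simp]: "n \<in> carrier A" using n by (simp add: peirce_def)

lemma table [simp]:
  "e \<otimes> f = \<zero>" "f \<otimes> e = \<zero>" "f \<otimes> f = f" "e \<otimes> n = n" "n \<otimes> f = n"
  "n \<otimes> e = \<zero>" "f \<otimes> n = \<zero>" "n \<otimes> n = \<zero>"
proof -
  show ef: "e \<otimes> f = \<zero>" "f \<otimes> e = \<zero>" "f \<otimes> f = f"
    by (simp_all add: f_eq minus_eq r_distr l_distr r_minus l_minus r_neg l_neg)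
  show en: "e \<otimes> n = n" "n \<otimes> f = n" using n by (auto simp: peirce_def)
  show ne: "n \<otimes> e = \<zero>" using ef en by (metis m_assoc e f n_closed r_null)
  show "f \<otimes> n = \<zero>" using ef en by (metis m_assoc e f n_closed l_null)
  show "n \<otimes> n = \<zero>" using ne en by (metis m_assoc e n_closed l_null)
qed

lemma e_plus_f: "e \<oplus> f = \<one>"
  using a_assoc[of \<one> "\<ominus> e" e] by (simp add: f_eq minus_eq a_comm[of e] l_neg)

lemma split_left: "x \<in> carrier A \<Longrightarrow> x = e \<otimes> x \<oplus> f \<otimes> x"
  using e_plus_f by (metis l_distr l_one e f)

lemma split_right: "x \<in> carrier A \<Longrightarrow> x = x \<otimes> e \<oplus> x \<otimes> f"
  using e_plus_f by (metis r_distr r_one e f)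

text \<open>
  The bound \<open>|e A f| |f A e| \<le> q\<close> is attained by \<open>F n\<close> alone, which leaves only \<open>0\<close> for \<open>f A e\<close>.
\<close>
lemma
  shows peirce_ef: "peirce e f = (\<lambda>t. t \<odot> n) ` carrier F"
    and peirce_fe: "peirce f e = {\<zero>}"
proof -
  have c0: "0 < card (centralizer e)"
    by (auto simp: card_gt_0_iff centralizer_def A_finite intro!: exI[of _ \<zero>])
  have "card (centralizer e) * (card (peirce e f) * card (peirce f e)) \<le> card (carrier A)"
    by (rule card_peirce[OF e ee f_eq])
  also have "\<dots> \<le> card (centralizer e) * q"
    using card_centralizer_idempotent[OF e ee] by (simp only: mult.commute)
  finally have "card (centralizer e) * (card (peirce e f) * card (peirce f e)) \<le> card (centralizer e) * q" .
  then have le: "card (peirce e f) * card (peirce f e) \<le> q" using c0 by simp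
  have sub: "(\<lambda>t. t \<odot> n) ` carrier F \<subseteq> peirce e f"
    by (auto simp: peirce_def S.smult_assoc2 S.smult_assoc3)
  have inj: "inj_on (\<lambda>t. t \<odot> n) (carrier F)"
    using smult_cancel_right[OF _ _ n_closed n_nonzero] by (auto intro!: inj_onI)
  have fin: "finite (peirce e f)" "finite (peirce f e)" by (auto simp: peirce_def A_finite)
  have cq: "card ((\<lambda>t. t \<odot> n) ` carrier F) = q" using card_image[OF inj] F_card by simp
  then have ge: "q \<le> card (peirce e f)" using card_mono[OF fin(1) sub] by simp
  have z: "\<zero> \<in> peirce f e" by (simp add: peirce_def)
  then have "0 < card (peirce f e)" using fin by (auto simp: card_gt_0_iff)
  then have "card (peirce e f) \<le> q" using le
    by (metis One_nat_def Suc_leI le_trans mult.right_neutral mult_le_mono2)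
  then show "peirce e f = (\<lambda>t. t \<odot> n) ` carrier F"
    using card_subset_eq[OF fin(1) sub] cq ge by simp
  have "q * card (peirce f e) \<le> q * 1" using le ge by (metis le_trans mult.right_neutral mult_le_mono1)
  then have "card (peirce f e) \<le> 1" using q_ge_2 by simp
  then show "peirce f e = {\<zero>}"
    using z card_le_Suc0_iff_eq[OF fin(2)] by auto
qed

lemma fxe [simp]:
  assumes x: "x \<in> carrier A"
  shows "f \<otimes> (x \<otimes> e) = \<zero>"
proof -
  have "f \<otimes> (x \<otimes> e) \<in> peirce f e"
    using x by (simp add: peirce_def m_assoc) (simp add: m_assoc[symmetric])
  then show ?thesis using peirce_fe by blast
qed

text \<open>
  The fibres of the additive map \<open>x \<mapsto> x n - n x\<close> into \<open>e A f = F n\<close> are translates of \<open>C(n)\<close>.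
\<close>
lemma card_centralizer_arrow: "card (carrier A) \<le> q * card (centralizer n)"
proof -
  let ?D = "\<lambda>x. x \<otimes> n \<ominus> n \<otimes> x"
  have D: "?D x \<in> peirce e f" if x: "x \<in> carrier A" for x
  proof -
    have fxn: "f \<otimes> (x \<otimes> n) = \<zero>"
      using fxe[OF x] x by (metis table(4) m_assoc m_closed e f n_closed l_null)
    then have 1: "e \<otimes> (x \<otimes> n) = x \<otimes> n" using split_left[of "x \<otimes> n"] x by simp
    have nxe: "n \<otimes> (x \<otimes> e) = \<zero>"
      using fxe[OF x] x by (metis table(5) m_assoc m_closed e f n_closed r_null)
    then have 2: "n \<otimes> (x \<otimes> f) = n \<otimes> x"
      using split_right[of "n \<otimes> x"] x by (simp add: m_assoc)
    have 3: "e \<otimes> (n \<otimes> x) = n \<otimes> x" using x by (simp add: m_assoc[symmetric])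
    show ?thesis using x 1 2 3
      by (simp add: peirce_def minus_eq r_distr l_distr r_minus l_minus m_assoc)
  qed
  let ?fib = "\<lambda>v. {x \<in> carrier A. ?D x = v}"
  have fibre: "card (?fib v) \<le> card (centralizer n)" for v
  proof (cases "?fib v = {}")
    case True
    then show ?thesis by (simp only: card.empty)
  next
    case False
    then obtain z where z: "z \<in> carrier A" "?D z = v" by blast
    have "(\<lambda>x. x \<ominus> z) ` ?fib v \<subseteq> centralizer n"
    proof clarsimp
      fix x assume x: "x \<in> carrier A" and v: "v = ?D x"
      then have eq: "x \<otimes> n \<ominus> n \<otimes> x = z \<otimes> n \<ominus> n \<otimes> z" using z by simp
      have "(x \<ominus> z) \<otimes> n \<ominus> n \<otimes> (x \<ominus> z) = (x \<otimes> n \<ominus> n \<otimes> x) \<ominus> (z \<otimes> n \<ominus> n \<otimes> z)"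
        using x z(1) by (simp add: minus_eq r_distr l_distr r_minus l_minus minus_add a_ac)
      also have "\<dots> = \<zero>" unfolding eq using z(1) by simp
      finally show "x \<ominus> z \<in> centralizer n"
        using x z(1) by (simp add: centralizer_def)
    qed
    moreover have "inj_on (\<lambda>x. x \<ominus> z) (?fib v)"
      using z by (auto intro!: inj_onI simp: minus_eq)
    ultimately show ?thesis
      using card_inj_on_le by (metis (no_types, lifting) A_finite centralizer_def finite_Collect_conjI finite_subsets mem_Collect_eq subsetI)
  qed
  have "carrier A \<subseteq> (\<Union>v\<in>peirce e f. ?fib v)" using D by blast
  then have "card (carrier A) \<le> card (\<Union>v\<in>peirce e f. ?fib v)"
    by (intro card_mono) (auto simp: peirce_ef F_finite A_finite)
  also have "\<dots> \<le> (\<Sum>v\<in>peirce e f. card (?fib v))"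
    by (rule card_UN_le) (simp add: peirce_ef F_finite)
  also have "\<dots> \<le> (\<Sum>v\<in>peirce e f. card (centralizer n))" by (intro sum_mono fibre)
  also have "\<dots> = card (peirce e f) * card (centralizer n)" by simp
  also have "card (peirce e f) \<le> q" unfolding peirce_ef F_card[symmetric] by (rule card_image_le[OF F_finite])
  finally show ?thesis by simp
qed

lemma pow_q_add_arrow:
  assumes "x \<in> centralizer n" "t \<in> carrier F"
  shows "(x \<oplus> t \<odot> n) [^] q = x [^] q"
  using assms by (intro add_nilpotent_pow_q)
    (auto simp: centralizer_def S.smult_assoc2 S.smult_assoc3)

text \<open>
  Different points of \<open>I \<inter> C(n)\<close> lie on different lines \<open>x + F n\<close>, since \<open>x = x\<^sup>q = (x + t n)\<^sup>q\<close> can be read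
  off from the line. If some line in \<open>C(n)\<close> missed \<open>I\<close>, then \<open>q |I \<inter> C(n)| < |C(n)|\<close>, and the complement of \<open>I\<close>
  would have more than \<open>(q - 1)/q |C(n)| \<ge> (q - 1)/q\<^sup>2 |A|\<close> elements.
\<close>
lemma centralizer_arrow_meets_I:
  assumes y: "y \<in> centralizer n"
  shows "\<exists>t\<in>carrier F. y \<oplus> t \<odot> n \<in> I_set A q"
proof (rule ccontr)
  assume no: "\<not> (\<exists>t\<in>carrier F. y \<oplus> t \<odot> n \<in> I_set A q)"
  define C where "C = centralizer n"
  have Csub: "C \<subseteq> carrier A" by (auto simp: C_def centralizer_def)
  have finC: "finite C" using Csub by simp
  \<comment> \<open>The lines through the points of \<open>I \<inter> C(n)\<close> are disjoint and avoid \<open>y\<close>.\<close>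
  let ?g = "\<lambda>(x, t). x \<oplus> t \<odot> n"
  have "inj_on ?g ((I_set A q \<inter> C) \<times> carrier F)"
  proof (rule inj_onI, clarsimp)
    fix x t x' t'
    assume x: "x \<in> I_set A q" "x \<in> C" "x' \<in> I_set A q" "x' \<in> C"
      and t: "t \<in> carrier F" "t' \<in> carrier F" and eq: "x \<oplus> t \<odot> n = x' \<oplus> t' \<odot> n"
    have "x [^] q = x' [^] q"
      using pow_q_add_arrow[of x t] pow_q_add_arrow[of x' t'] x t eq by (simp add: C_def)
    then have xx: "x = x'" using x by (simp add: I_set_def)
    then have "t \<odot> n = t' \<odot> n" using eq x t Csub by (auto simp: subset_iff)
    then show "x = x' \<and> t = t'" using xx smult_cancel_right[OF t n_closed n_nonzero] by simp
  qed
  then have "card ((I_set A q \<inter> C) \<times> carrier F) = card (?g ` ((I_set A q \<inter> C) \<times> carrier F))"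
    by (rule card_image[symmetric])
  also have "\<dots> \<le> card (C - {y})"
  proof (intro card_mono)
    show "?g ` ((I_set A q \<inter> C) \<times> carrier F) \<subseteq> C - {y}"
    proof clarsimp
      fix x t assume x: "x \<in> I_set A q" "x \<in> C" and t: "t \<in> carrier F"
      have xc: "x \<in> carrier A" using x Csub by blast
      have "x \<oplus> t \<odot> n \<in> C" using x t
        by (auto simp: C_def centralizer_def r_distr l_distr S.smult_assoc2 S.smult_assoc3)
      moreover have "x \<oplus> t \<odot> n \<noteq> y"
      proof
        assume yx: "x \<oplus> t \<odot> n = y"
        have "y \<oplus> (\<ominus>\<^bsub>F\<^esub> t) \<odot> n = x"
          unfolding yx[symmetric] using xc t by (simp add: S.smult_l_minus a_assoc r_neg)
        then show False using no t x(1) by (metis F.a_inv_closed)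
      qed
      ultimately show "x \<oplus> t \<odot> n \<in> C \<and> x \<oplus> t \<odot> n \<noteq> y" ..
    qed
  qed (simp add: finC)
  also have "\<dots> < card C" by (rule card_Diff1_less[OF finC]) (use y in \<open>simp add: C_def\<close>)
  finally have less: "q * card (I_set A q \<inter> C) < card C"
    by (simp add: card_cartesian_product F_card mult.commute)
  have "C \<subseteq> (I_set A q \<inter> C) \<union> (carrier A - I_set A q)" using Csub by blast
  then have "card C \<le> card ((I_set A q \<inter> C) \<union> (carrier A - I_set A q))"
    by (intro card_mono) (auto simp: finC A_finite)
  also have "\<dots> \<le> card (I_set A q \<inter> C) + card (carrier A - I_set A q)" by (rule card_Un_le)
  finally have "q * (q * card C) \<le> q * (q * (card (I_set A q \<inter> C) + card (carrier A - I_set A q)))"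
    by simp
  also have "\<dots> = q * (q * card (I_set A q \<inter> C)) + q\<^sup>2 * card (carrier A - I_set A q)"
    by (simp add: algebra_simps power2_eq_square)
  also have "\<dots> = q * (q * card (I_set A q \<inter> C)) + (q - 1) * card (carrier A)"
    by (simp only: card_complement)
  also have "\<dots> < q * card C + (q - 1) * (q * card C)"
    using less q_ge_2 card_centralizer_arrow by (intro add_less_le_mono) (auto simp: C_def)
  also have "\<dots> = q * (q * card C)" using q_ge_2 by (cases q) auto
  finally show False by simp
qed

text \<open>
  Let \<open>a n = t n\<close>. Completing \<open>a\<close> by \<open>t f\<close> in the opposite corner gives an element that commutes with
  \<open>n\<close>. Some point of its line \<open>a + t f + F n\<close> lies in \<open>I\<close>, and adding a multiple of \<open>n\<close> does not change the
  diagonal block \<open>a\<close>.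
\<close>
lemma corner_e_in_I: "peirce e e \<subseteq> I_set A q"
proof
  fix a assume a: "a \<in> peirce e e"
  note a' = peirceD[OF a]
  have "a \<otimes> n \<in> peirce e f" using a' by (simp add: peirce_def m_assoc) (simp add: m_assoc[symmetric])
  then obtain t where t: "t \<in> carrier F" "a \<otimes> n = t \<odot> n" using peirce_ef by auto
  have na: "n \<otimes> a = \<zero>" using a' by (metis table(6) m_assoc e n_closed l_null)
  define y where "y = a \<oplus> t \<odot> f"
  have y: "y \<in> centralizer n" using a' t na
    by (simp add: centralizer_def y_def r_distr l_distr S.smult_assoc2 S.smult_assoc3)
  then obtain s where s: "s \<in> carrier F" "y \<oplus> s \<odot> n \<in> I_set A q"
    using centralizer_arrow_meets_I by blast
  then have yq: "y [^] q = y \<oplus> s \<odot> n" using pow_q_add_arrow[OF y s(1)] by (simp add: I_set_def)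
  show "a \<in> I_set A q"
  proof (rule corner_in_I[OF e a])
    show yc: "y \<in> carrier A" using y by (simp add: centralizer_def)
    show ye: "y \<otimes> e = a" using a' t by (simp add: y_def l_distr S.smult_assoc2)
    show "e \<otimes> (y [^] q \<otimes> e) = a"
      unfolding yq using a' yc ye s by (simp add: l_distr S.smult_assoc2)
  qed
qed

lemma corner_f_in_I: "peirce f f \<subseteq> I_set A q"
proof
  fix b assume b: "b \<in> peirce f f"
  note b' = peirceD[OF b]
  have "n \<otimes> b \<in> peirce e f" using b' by (simp add: peirce_def m_assoc) (simp add: m_assoc[symmetric])
  then obtain t where t: "t \<in> carrier F" "n \<otimes> b = t \<odot> n" using peirce_ef by auto
  have bn: "b \<otimes> n = \<zero>" using b' by (metis table(7) m_assoc f n_closed r_null)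
  define y where "y = b \<oplus> t \<odot> e"
  have y: "y \<in> centralizer n" using b' t bn
    by (simp add: centralizer_def y_def r_distr l_distr S.smult_assoc2 S.smult_assoc3)
  then obtain s where s: "s \<in> carrier F" "y \<oplus> s \<odot> n \<in> I_set A q"
    using centralizer_arrow_meets_I by blast
  then have yq: "y [^] q = y \<oplus> s \<odot> n" using pow_q_add_arrow[OF y s(1)] by (simp add: I_set_def)
  show "b \<in> I_set A q"
  proof (rule corner_in_I[OF f b])
    show yc: "y \<in> carrier A" using y by (simp add: centralizer_def)
    show yf: "y \<otimes> f = b" using b' t by (simp add: y_def l_distr S.smult_assoc2)
    show "f \<otimes> (y [^] q \<otimes> f) = b"
      unfolding yq using b' yc yf s by (simp add: l_distr r_distr S.smult_assoc2 S.smult_assoc3)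
  qed
qed

text \<open>
  In the decomposition \<open>x = e x e + e x f + f x f\<close> the idempotent \<open>g\<close> built from \<open>a\<close> commutes with the first
  part because it is central in its corner, kills \<open>e x f\<close>, a multiple of \<open>n\<close>, on both sides, and
  kills the third part because \<open>g = e g e\<close>. So \<open>g\<close> is central, but \<open>g n = 0\<close> and \<open>g \<noteq> 0\<close> exclude \<open>g = 1\<close> and
  \<open>g = 0\<close>.
\<close>
lemma annihilator_e:
  assumes a: "a \<in> peirce e e" and an: "a \<otimes> n = \<zero>"
  shows "a = \<zero>"
proof (rule ccontr)
  assume "a \<noteq> \<zero>"
  then obtain g c where g: "g \<in> peirce e e" "g \<otimes> g = g" "g \<noteq> \<zero>"
    and comm: "\<And>x. x \<in> peirce e e \<Longrightarrow> g \<otimes> x = x \<otimes> g"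
    and c: "c \<in> carrier A" "g = c \<otimes> a"
    using corner_idempotent[OF e corner_e_in_I a] by metis
  note g' = peirceD[OF g(1)]
  have gn: "g \<otimes> n = \<zero>" using c an peirceD(1)[OF a] by (simp add: m_assoc)
  have "g \<otimes> x = x \<otimes> g" if x: "x \<in> carrier A" for x
  proof -
    have exe: "e \<otimes> (x \<otimes> e) \<in> peirce e e"
      using x by (simp add: peirce_def m_assoc) (simp add: m_assoc[symmetric])
    have "e \<otimes> (x \<otimes> f) \<in> peirce e f"
      using x by (simp add: peirce_def m_assoc) (simp add: m_assoc[symmetric])
    then obtain s where s: "s \<in> carrier F" "e \<otimes> (x \<otimes> f) = s \<odot> n" using peirce_ef by auto
    have "g \<otimes> x = g \<otimes> (e \<otimes> x)" using g' x by (simp add: m_assoc[symmetric])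
    also have "e \<otimes> x = e \<otimes> (x \<otimes> e) \<oplus> e \<otimes> (x \<otimes> f)"
      using split_right[of "e \<otimes> x"] x by (simp add: m_assoc)
    also have "g \<otimes> \<dots> = g \<otimes> (e \<otimes> (x \<otimes> e))"
      using s g' x gn by (simp add: r_distr S.smult_assoc3)
    also have "\<dots> = e \<otimes> (x \<otimes> e) \<otimes> g" by (rule comm[OF exe])
    also have "e \<otimes> (x \<otimes> e) = x \<otimes> e"
      using split_left[of "x \<otimes> e"] x by simp
    also have "x \<otimes> e \<otimes> g = x \<otimes> g" using g' x by (simp add: m_assoc)
    finally show ?thesis .
  qed
  then have "g = \<zero> \<or> g = \<one>" using central_idempotent g' g(2) by blast
  then show False using g(3) gn n_nonzero by auto
qed

text \<open>
  The mirror image of the previous argument: \<open>f A f\<close> acts on \<open>F n\<close> from the right.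
\<close>
lemma annihilator_f:
  assumes b: "b \<in> peirce f f" and nb: "n \<otimes> b = \<zero>"
  shows "b = \<zero>"
proof (rule ccontr)
  assume "b \<noteq> \<zero>"
  then obtain g c where g: "g \<in> peirce f f" "g \<otimes> g = g" "g \<noteq> \<zero>"
    and comm: "\<And>x. x \<in> peirce f f \<Longrightarrow> g \<otimes> x = x \<otimes> g"
    and c: "c \<in> carrier A" "g = b \<otimes> c"
    using corner_idempotent[OF f corner_f_in_I b] by metis
  note g' = peirceD[OF g(1)]
  have ng: "n \<otimes> g = \<zero>" using c nb peirceD(1)[OF b] by (simp add: m_assoc[symmetric])
  have "g \<otimes> x = x \<otimes> g" if x: "x \<in> carrier A" for x
  proof -
    have fxf: "f \<otimes> (x \<otimes> f) \<in> peirce f f"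
      using x by (simp add: peirce_def m_assoc) (simp add: m_assoc[symmetric])
    have "e \<otimes> (x \<otimes> f) \<in> peirce e f"
      using x by (simp add: peirce_def m_assoc) (simp add: m_assoc[symmetric])
    then obtain s where s: "s \<in> carrier F" "e \<otimes> (x \<otimes> f) = s \<odot> n" using peirce_ef by auto
    have "x \<otimes> g = x \<otimes> f \<otimes> g" using g' x by (simp add: m_assoc)
    also have "x \<otimes> f = e \<otimes> (x \<otimes> f) \<oplus> f \<otimes> (x \<otimes> f)"
      using split_left[of "x \<otimes> f"] x by simp
    also have "\<dots> \<otimes> g = f \<otimes> (x \<otimes> f) \<otimes> g"
      using s g' x ng by (simp add: l_distr S.smult_assoc2)
    also have "\<dots> = g \<otimes> (f \<otimes> (x \<otimes> f))" by (rule comm[OF fxf, symmetric])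
    also have "f \<otimes> (x \<otimes> f) = f \<otimes> x"
      using split_right[of "f \<otimes> x"] x by (simp add: m_assoc)
    also have "g \<otimes> (f \<otimes> x) = g \<otimes> x" using g' x by (simp add: m_assoc[symmetric])
    finally show ?thesis by simp
  qed
  then have "g = \<zero> \<or> g = \<one>" using central_idempotent g' g(2) by blast
  then show False using g(3) ng n_nonzero by auto
qed

text \<open>
  If \<open>a n = t n\<close>, then \<open>a - t e\<close> annihilates \<open>n\<close>.
\<close>
lemma corner_e_scalar:
  assumes a: "a \<in> peirce e e"
  shows "\<exists>t\<in>carrier F. a = t \<odot> e"
proof -
  note a' = peirceD[OF a]
  have "a \<otimes> n \<in> peirce e f" using a' by (simp add: peirce_def m_assoc) (simp add: m_assoc[symmetric])
  then obtain t where t: "t \<in> carrier F" "a \<otimes> n = t \<odot> n" using peirce_ef by auto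
  have "a \<ominus> t \<odot> e \<in> peirce e e" using a' t
    by (simp add: peirce_def minus_eq r_distr l_distr r_minus l_minus S.smult_assoc2 S.smult_assoc3)
  moreover have "(a \<ominus> t \<odot> e) \<otimes> n = \<zero>" using a' t
    by (simp add: minus_eq l_distr l_minus S.smult_assoc2 r_neg)
  ultimately have "a \<ominus> t \<odot> e = \<zero>" by (rule annihilator_e)
  then show ?thesis using a' t by auto
qed

lemma corner_f_scalar:
  assumes b: "b \<in> peirce f f"
  shows "\<exists>t\<in>carrier F. b = t \<odot> f"
proof -
  note b' = peirceD[OF b]
  have "n \<otimes> b \<in> peirce e f" using b' by (simp add: peirce_def m_assoc) (simp add: m_assoc[symmetric])
  then obtain t where t: "t \<in> carrier F" "n \<otimes> b = t \<odot> n" using peirce_ef by auto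
  have "b \<ominus> t \<odot> f \<in> peirce f f" using b' t
    by (simp add: peirce_def minus_eq r_distr l_distr r_minus l_minus S.smult_assoc2 S.smult_assoc3)
  moreover have "n \<otimes> (b \<ominus> t \<odot> f) = \<zero>" using b' t
    by (simp add: minus_eq r_distr r_minus S.smult_assoc3 r_neg)
  ultimately have "b \<ominus> t \<odot> f = \<zero>" by (rule annihilator_f)
  then show ?thesis using b' t by auto
qed

lemma triangular:
  assumes x: "x \<in> carrier A"
  obtains a b c where "a \<in> carrier F" "b \<in> carrier F" "c \<in> carrier F"
    "x = a \<odot> e \<oplus> c \<odot> n \<oplus> b \<odot> f"
proof -
  have "e \<otimes> (x \<otimes> e) \<in> peirce e e" "e \<otimes> (x \<otimes> f) \<in> peirce e f" "f \<otimes> (x \<otimes> f) \<in> peirce f f"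
    using x by (simp_all add: peirce_def m_assoc) (simp_all add: m_assoc[symmetric])
  then obtain a b c where abc: "a \<in> carrier F" "b \<in> carrier F" "c \<in> carrier F"
    and "e \<otimes> (x \<otimes> e) = a \<odot> e" "e \<otimes> (x \<otimes> f) = c \<odot> n" "f \<otimes> (x \<otimes> f) = b \<odot> f"
    using corner_e_scalar corner_f_scalar peirce_ef by (metis (no_types, lifting) imageE)
  moreover have "x = (e \<otimes> (x \<otimes> e) \<oplus> f \<otimes> (x \<otimes> e)) \<oplus> (e \<otimes> (x \<otimes> f) \<oplus> f \<otimes> (x \<otimes> f))"
    using split_left[of "x \<otimes> e"] split_left[of "x \<otimes> f"] split_right[OF x] x
    by (metis m_closed e f)
  ultimately have "x = a \<odot> e \<oplus> c \<odot> n \<oplus> b \<odot> f"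
    using x by (simp add: a_assoc)
  then show thesis using that abc by blast
qed

section \<open>The isomorphism with the algebra of triangular matrices\<close>

text \<open>
  The generators of \<open>S\<close> are sent to \<open>e\<^sub>1 = f\<close> and \<open>e\<^sub>2 = f + n\<close>; both are idempotent, and a product of two of
  them equals the left factor because \<open>f n = 0\<close> and \<open>n f = n\<close>.
\<close>
definition from_S :: "'k \<times> 'k \<times> 'k \<Rightarrow> 'a" where
  "from_S = (\<lambda>(a, b, c). a \<odot> \<one> \<oplus> b \<odot> f \<oplus> c \<odot> (f \<oplus> n))"

text \<open>
  The coefficients can be read off: the block at \<open>e\<close> is \<open>a\<close>, the block above the diagonal is \<open>c\<close>, and the
  block at \<open>f\<close> is \<open>a + b + c\<close>.
\<close>
lemma from_S_inj:
  assumes "a \<in> carrier F" "b \<in> carrier F" "c \<in> carrier F"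
    and "a' \<in> carrier F" "b' \<in> carrier F" "c' \<in> carrier F"
    and eq: "from_S (a, b, c) = from_S (a', b', c')"
  shows "(a, b, c) = (a', b', c')"
proof -
  have val: "e \<otimes> from_S (a, b, c) \<otimes> e = a \<odot> e" "e \<otimes> from_S (a, b, c) \<otimes> f = c \<odot> n"
    "f \<otimes> from_S (a, b, c) = a \<odot> f \<oplus> b \<odot> f \<oplus> c \<odot> f"
    if "a \<in> carrier F" "b \<in> carrier F" "c \<in> carrier F" for a b c
    using that by (simp_all add: from_S_def r_distr l_distr S.smult_r_distr S.smult_assoc2 S.smult_assoc3)
  have e0: "e \<noteq> \<zero>" "f \<noteq> \<zero>"
    using table(4,5) n_nonzero l_null[OF n_closed] r_null[OF n_closed] by metis+
  have "a \<odot> e = a' \<odot> e" "c \<odot> n = c' \<odot> n" 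
    using val(1,2)[OF assms(1-3)] val(1,2)[OF assms(4-6)] eq by simp_all
  then have ac: "a = a'" "c = c'"
    using smult_cancel_right[OF assms(1,4) e e0(1)] smult_cancel_right[OF assms(3,6) n_closed n_nonzero]
    by simp_all
  have "a \<odot> f \<oplus> b \<odot> f \<oplus> c \<odot> f = a \<odot> f \<oplus> b' \<odot> f \<oplus> c \<odot> f"
    using val(3)[OF assms(1-3)] val(3)[OF assms(4-6)] eq ac by simp
  then have "b \<odot> f = b' \<odot> f" using assms ac by simp
  then show ?thesis using ac smult_cancel_right[OF assms(2,5) f e0(2)] by simp
qed

lemma from_S_surj:
  assumes "x \<in> carrier A"
  shows "x \<in> from_S ` carrier (S_alg F)"
proof -
  obtain a b c where abc: "a \<in> carrier F" "b \<in> carrier F" "c \<in> carrier F"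
    and x: "x = a \<odot> e \<oplus> c \<odot> n \<oplus> b \<odot> f"
    using triangular[OF assms] by metis
  \<comment> \<open>The block of the image at \<open>f\<close> is \<open>a + d + c\<close>, and it has to equal \<open>b\<close>.\<close>
  define d where "d = b \<ominus>\<^bsub>F\<^esub> a \<ominus>\<^bsub>F\<^esub> c"
  have d: "d \<in> carrier F" using abc by (simp add: d_def)
  have b: "b = a \<oplus>\<^bsub>F\<^esub> d \<oplus>\<^bsub>F\<^esub> c"
    using abc by (simp add: d_def F.minus_eq F.a_ac F.r_neg1 F.r_neg2)
      (metis F.a_comm F.a_inv_closed F.r_neg2 F.a_assoc F.l_neg F.r_zero F.a_closed)
  have "x = from_S (a, d, c)"
    unfolding x from_S_def b using abc d
    by (simp add: e_plus_f[symmetric] S.smult_l_distr S.smult_r_distr a_ac)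
  then show ?thesis using abc d by (auto simp: S_alg_def)
qed

lemma from_S_iso: "from_S \<in> ring_iso (S_alg F) A"
proof (rule ring_iso_memI)
  show "from_S x \<in> carrier A" if "x \<in> carrier (S_alg F)" for x
    using that by (auto simp: S_alg_def from_S_def)
  show "from_S (x \<otimes>\<^bsub>S_alg F\<^esub> y) = from_S x \<otimes> from_S y"
    if "x \<in> carrier (S_alg F)" "y \<in> carrier (S_alg F)" for x y
  proof -
    obtain a b c a' b' c' where xy: "x = (a, b, c)" "y = (a', b', c')"
      and [simp]: "a \<in> carrier F" "b \<in> carrier F" "c \<in> carrier F"
        "a' \<in> carrier F" "b' \<in> carrier F" "c' \<in> carrier F"
      using \<open>x \<in> carrier (S_alg F)\<close> \<open>y \<in> carrier (S_alg F)\<close> by (auto simp: S_alg_def)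
    define g where "g = f \<oplus> n"
    have g: "g \<in> carrier A" "f \<otimes> f = f" "f \<otimes> g = f" "g \<otimes> f = g" "g \<otimes> g = g"
      by (simp_all add: g_def r_distr l_distr)
    show ?thesis
      unfolding xy from_S_def g_def[symmetric] using g
      by (simp add: S_alg_def r_distr l_distr S.smult_l_distr S.smult_r_distr
          S.smult_assoc1 S.smult_assoc2 S.smult_assoc3 smult_comm a_ac)
  qed
  show "from_S (x \<oplus>\<^bsub>S_alg F\<^esub> y) = from_S x \<oplus> from_S y"
    if "x \<in> carrier (S_alg F)" "y \<in> carrier (S_alg F)" for x y
    using that by (auto simp: S_alg_def from_S_def S.smult_l_distr a_ac)
  show "from_S \<one>\<^bsub>S_alg F\<^esub> = \<one>" by (simp add: S_alg_def from_S_def)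
  have "inj_on from_S (carrier (S_alg F))"
    using from_S_inj by (auto simp: S_alg_def intro!: inj_onI)
  moreover have "from_S ` carrier (S_alg F) = carrier A"
    using from_S_surj by (auto simp: S_alg_def from_S_def)
  ultimately show "bij_betw from_S (carrier (S_alg F)) (carrier A)"
    by (simp add: bij_betw_def)
qed

lemma from_S_smult:
  assumes "k \<in> carrier F" "x \<in> carrier (S_alg F)"
  shows "from_S (k \<odot>\<^bsub>S_alg F\<^esub> x) = k \<odot> from_S x"
  using assms by (auto simp: S_alg_def from_S_def S.smult_r_distr S.smult_assoc1)

lemma isomorphic_S: "algebra_isomorphic F A (S_alg F)"
proof -
  interpret S_ring: ring "S_alg F" by (rule F.S_ring)
  let ?g = "inv_into (carrier (S_alg F)) from_S"
  have bij: "bij_betw from_S (carrier (S_alg F)) (carrier A)"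
    using from_S_iso by (simp add: ring_iso_def)
  have "?g \<in> ring_iso A (S_alg F)"
    by (rule ring_iso_set_sym[OF S_ring.ring_axioms from_S_iso])
  moreover have "?g (k \<odot> x) = k \<odot>\<^bsub>S_alg F\<^esub> ?g x" if k: "k \<in> carrier F" and x: "x \<in> carrier A" for k x
  proof -
    have gx: "?g x \<in> carrier (S_alg F)" "from_S (?g x) = x"
      using x bij by (auto simp: bij_betw_def inv_into_into f_inv_into_f)
    then have "from_S (k \<odot>\<^bsub>S_alg F\<^esub> ?g x) = k \<odot> x" using from_S_smult k by simp
    moreover have "k \<odot>\<^bsub>S_alg F\<^esub> ?g x \<in> carrier (S_alg F)"
      using gx(1) k by (auto simp: S_alg_def)
    ultimately show ?thesis using bij by (metis bij_betw_def inv_into_f_f)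
  qed
  ultimately show ?thesis by (auto simp: algebra_isomorphic_def algebra_iso_def)
qed

end

section \<open>Indecomposable rings and the characterization\<close>

text \<open>
  A central idempotent \<open>g\<close> splits the ring as \<open>g R \<times> (1 - g) R\<close>, where the factors have the units \<open>g\<close> and
  \<open>1 - g\<close>. For \<open>g\<close> other than \<open>0\<close> and \<open>1\<close> neither factor is zero.
\<close>
lemma (in ring) indecomposable_central_idempotent:
  assumes indec: "indecomposable_ring R"
    and g: "g \<in> carrier R" "g \<otimes> g = g" "\<And>x. x \<in> carrier R \<Longrightarrow> g \<otimes> x = x \<otimes> g"
  shows "g = \<zero> \<or> g = \<one>"
proof (rule ccontr)
  assume triv: "\<not> (g = \<zero> \<or> g = \<one>)"
  define C where "C = (\<lambda>h. \<lparr>carrier = {x \<in> carrier R. h \<otimes> x = x}, mult = mult R, one = h,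
    zero = \<zero>, add = add R\<rparr>)"
  have C_ring: "ring (C h)"
    if h: "h \<in> carrier R" "h \<otimes> h = h" "\<And>x. x \<in> carrier R \<Longrightarrow> h \<otimes> x = x \<otimes> h" for h
  proof (rule ringI)
    show "abelian_group (C h)"
    proof (rule abelian_groupI)
      fix x assume "x \<in> carrier (C h)"
      then show "\<exists>y\<in>carrier (C h). y \<oplus>\<^bsub>C h\<^esub> x = \<zero>\<^bsub>C h\<^esub>"
        using h(1) by (intro bexI[of _ "\<ominus> x"]) (simp_all add: C_def l_neg r_minus)
    qed (use h(1) in \<open>simp_all add: C_def a_ac r_distr\<close>)
    show "monoid (C h)"
    proof (rule monoidI)
      fix x y assume "x \<in> carrier (C h)" "y \<in> carrier (C h)"
      then show "x \<otimes>\<^bsub>C h\<^esub> y \<in> carrier (C h)"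
        using h(1) by (simp add: C_def m_assoc[symmetric])
    next
      fix x assume "x \<in> carrier (C h)"
      then show "x \<otimes>\<^bsub>C h\<^esub> \<one>\<^bsub>C h\<^esub> = x"
        using h(3)[of x] by (simp add: C_def)
    qed (use h(1,2) in \<open>simp_all add: C_def m_assoc\<close>)
  qed (simp_all add: C_def l_distr r_distr)
  define k where "k = \<one> \<ominus> g"
  have k: "k \<in> carrier R" "k \<otimes> k = k" "g \<otimes> k = \<zero>" "k \<otimes> g = \<zero>"
    using g(1,2) by (simp_all add: k_def minus_eq r_distr l_distr r_minus l_minus r_neg l_neg)
  have kcomm: "k \<otimes> x = x \<otimes> k" if "x \<in> carrier R" for x
    using that g(1) g(3)[OF that] by (simp add: k_def minus_eq r_distr l_distr r_minus l_minus)
  have sum: "g \<otimes> x \<oplus> k \<otimes> x = x" if "x \<in> carrier R" for x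
  proof -
    have "g \<otimes> x \<oplus> k \<otimes> x = (g \<oplus> k) \<otimes> x" using that g(1) k(1) by (simp add: l_distr)
    also have "g \<oplus> k = \<one>" using g(1) a_assoc[of \<one> "\<ominus> g" g]
      by (simp add: k_def minus_eq a_comm[of g] l_neg)
    finally show ?thesis using that by simp
  qed
  have k0: "k \<noteq> \<zero>" using triv g(1) r_right_minus_eq[of \<one> g] by (auto simp: k_def)
  have idem: "g \<otimes> (g \<otimes> x) = g \<otimes> x" "k \<otimes> (k \<otimes> x) = k \<otimes> x"
    "g \<otimes> (k \<otimes> x) = \<zero>" "k \<otimes> (g \<otimes> x) = \<zero>"
    if "x \<in> carrier R" for x
    using that g(1,2) k by (simp_all add: m_assoc[symmetric])
  have "(\<lambda>x. (g \<otimes> x, k \<otimes> x)) \<in> ring_iso R (RDirProd (C g) (C k))"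
  proof (rule ring_iso_memI)
    fix x y assume xy: "x \<in> carrier R" "y \<in> carrier R"
    have mult: "h \<otimes> (x \<otimes> y) = (h \<otimes> x) \<otimes> (h \<otimes> y)"
      if h: "h \<in> carrier R" "h \<otimes> h = h" "\<And>x. x \<in> carrier R \<Longrightarrow> h \<otimes> x = x \<otimes> h" for h
    proof -
      have "(h \<otimes> x) \<otimes> (h \<otimes> y) = h \<otimes> (x \<otimes> h) \<otimes> y" using xy h(1) by (simp add: m_assoc)
      also have "x \<otimes> h = h \<otimes> x" using h(3) xy by simp
      also have "h \<otimes> (h \<otimes> x) \<otimes> y = (h \<otimes> h) \<otimes> (x \<otimes> y)" using xy h(1) by (simp add: m_assoc)
      finally show ?thesis using h(2) by simp
    qed
    show "(g \<otimes> (x \<otimes> y), k \<otimes> (x \<otimes> y)) = (g \<otimes> x, k \<otimes> x) \<otimes>\<^bsub>RDirProd (C g) (C k)\<^esub> (g \<otimes> y, k \<otimes> y)"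
      using mult[OF g] mult[OF k(1,2) kcomm]
      by (simp add: RDirProd_def DirProd_def monoid.defs C_def)
    show "(g \<otimes> (x \<oplus> y), k \<otimes> (x \<oplus> y)) = (g \<otimes> x, k \<otimes> x) \<oplus>\<^bsub>RDirProd (C g) (C k)\<^esub> (g \<otimes> y, k \<otimes> y)"
      using xy g(1) k(1) by (simp add: RDirProd_def DirProd_def monoid.defs C_def r_distr)
  next
    show "(g \<otimes> \<one>, k \<otimes> \<one>) = \<one>\<^bsub>RDirProd (C g) (C k)\<^esub>"
      using g(1) k(1) by (simp add: RDirProd_def DirProd_def monoid.defs C_def)
    show "(g \<otimes> x, k \<otimes> x) \<in> carrier (RDirProd (C g) (C k))" if "x \<in> carrier R" for x
      using that g(1) k(1) idem by (simp add: RDirProd_carrier C_def)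
    show "bij_betw (\<lambda>x. (g \<otimes> x, k \<otimes> x)) (carrier R) (carrier (RDirProd (C g) (C k)))"
    proof (rule bij_betw_byWitness[where f' = "\<lambda>(u, v). u \<oplus> v"])
      show "\<forall>x\<in>carrier R. (case (g \<otimes> x, k \<otimes> x) of (u, v) \<Rightarrow> u \<oplus> v) = x" using sum by simp
      show "\<forall>p\<in>carrier (RDirProd (C g) (C k)).
          (g \<otimes> (case p of (u, v) \<Rightarrow> u \<oplus> v), k \<otimes> (case p of (u, v) \<Rightarrow> u \<oplus> v)) = p"
      proof (clarsimp simp: RDirProd_carrier C_def)
        fix u v assume uv: "u \<in> carrier R" "g \<otimes> u = u" "v \<in> carrier R" "k \<otimes> v = v"
        have "k \<otimes> u = \<zero>" using idem(4)[OF uv(1)] uv(2) by simp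
        moreover have "g \<otimes> v = \<zero>" using idem(3)[OF uv(3)] uv(4) by simp
        ultimately show "g \<otimes> (u \<oplus> v) = u \<and> k \<otimes> (u \<oplus> v) = v"
          using uv g(1) k(1) by (simp add: r_distr)
      qed
      show "(\<lambda>x. (g \<otimes> x, k \<otimes> x)) ` carrier R \<subseteq> carrier (RDirProd (C g) (C k))"
        using g(1) k(1) idem by (auto simp: RDirProd_carrier C_def)
      show "(\<lambda>(u, v). u \<oplus> v) ` carrier (RDirProd (C g) (C k)) \<subseteq> carrier R"
        by (auto simp: RDirProd_carrier C_def)
    qed
  qed
  then have "R \<simeq> RDirProd (C g) (C k)" by (auto simp: is_ring_iso_def)
  moreover have "ring (C g)" by (rule C_ring[OF g])
  moreover have "ring (C k)" by (rule C_ring[OF k(1,2) kcomm])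
  moreover have "carrier (C g) \<noteq> {\<zero>\<^bsub>C g\<^esub>}" "carrier (C k) \<noteq> {\<zero>\<^bsub>C k\<^esub>}"
    using triv g(1,2) k(1,2) k0 by (auto simp: C_def)
  ultimately show False using indec unfolding indecomposable_ring_def by blast
qed

theorem theorem2p6:
  fixes F :: "('k, 'c) ring_scheme" and R :: "('k, 'a, 'm) module_scheme" and q :: nat
  assumes "field F" and "finite (carrier F)" and "card (carrier F) = q"
    and "assoc_algebra F R" and "finite (carrier R)" and "indecomposable_ring R"
    and "r_ratio R q = ((real q)\<^sup>2 - real q + 1) / (real q)\<^sup>2"
  shows "algebra_isomorphic F R (S_alg F)"
proof -
  interpret finite_algebra R F q
    using assms by (simp add: finite_algebra_def finite_algebra_axioms_def assoc_algebra.axioms(2))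
  have N: "0 < card (carrier R)" using A_finite zero_closed by (auto simp: card_gt_0_iff)
  have I: "card (I_set R q) \<le> card (carrier R)" by (intro card_mono A_finite I_set_sub)
  have diff: "card (carrier R - I_set R q) = card (carrier R) - card (I_set R q)"
    by (intro card_Diff_subset finite_subsets I_set_sub)
  have "real (card (I_set R q)) * (real q)\<^sup>2 = ((real q)\<^sup>2 - real q + 1) * real (card (carrier R))"
    by (rule frac_eq_eq[THEN iffD1, OF _ _ assms(7)[unfolded r_ratio_def]]) (use N q_ge_2 in auto)
  then have "real (q\<^sup>2 * card (carrier R - I_set R q)) = real ((q - 1) * card (carrier R))"
    using I q_ge_2 by (simp add: diff of_nat_diff algebra_simps)
  then have complement: "q\<^sup>2 * card (carrier R - I_set R q) = (q - 1) * card (carrier R)"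
    by (simp only: of_nat_eq_iff)
  interpret dense_algebra R F q
    by unfold_locales (rule complement, rule indecomposable_central_idempotent[OF assms(6)])
  obtain e n where "e \<in> carrier R" "e \<otimes>\<^bsub>R\<^esub> e = e" "n \<in> peirce e (\<one>\<^bsub>R\<^esub> \<ominus>\<^bsub>R\<^esub> e)" "n \<noteq> \<zero>\<^bsub>R\<^esub>"
    by (rule exists_peirce_arrow)
  then interpret arrow_algebra R F q e "\<one>\<^bsub>R\<^esub> \<ominus>\<^bsub>R\<^esub> e" n
    by unfold_locales auto
  show ?thesis by (rule isomorphic_S)
qed

end
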